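(* Let $G=(V,E,w)$ be a finite vertex-weighted graph with nonnegative rational vertex weights and maximum degree $\Delta$, and let $d$ denote the number of distinct values in $\{w_v\}_{v\in V}$. For any integer $k\ge (8d+10)\Delta$, there exists an EQ1 $k$-coloring of $G$. Furthermore, such a coloring can be computed in polynomial time.
   Context: For $S\subseteq V$, $w(S)=\sum_{v\in S}w_v$. A $k$-coloring of $G$ is a partition $(C_1,\dots,C_k)$ of $V$ into $k$ (possibly empty) sets, each of which is an independent set of $G$. A coloring $(C_1,\dots,C_k)$ is EQ1 (equitable up to one vertex) if for every $i,j\in[k]$ with $C_i\neq\emptyset$ there exists a vertex $\bar v\in C_i$ such that $w(C_i\setminus\{\bar v\})\le w(C_j)$.
   Formalization: The number of colors k is assumed to be at least 1, since for an edgeless nonempty graph (Δ = 0) the literal statement would allow k = 0, where no k-coloring exists. *)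

theory Defs
  imports
    Complex_Main
    "HOL-Library.Disjoint_Sets"
    "HOL-Library.Discrete_Functions"
    "HOL-Computational_Algebra.Polynomial"
begin

section \<open>Graphs and colorings\<close>

definition simple_graph :: "'a set \<Rightarrow> 'a set set \<Rightarrow> bool" where
  "simple_graph V E \<longleftrightarrow> finite V \<and> (\<forall>e\<in>E. e \<subseteq> V \<and> card e = 2)"

definition vertex_degree :: "'a set set \<Rightarrow> 'a \<Rightarrow> nat" where
  "vertex_degree E v = card {e \<in> E. v \<in> e}"

definition max_degree :: "'a set \<Rightarrow> 'a set set \<Rightarrow> nat" where
  "max_degree V E = (if V = {} then 0 else Max (vertex_degree E ` V))"

definition independent_set :: "'a set \<Rightarrow> 'a set set \<Rightarrow> 'a set \<Rightarrow> bool" where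
  "independent_set V E S \<longleftrightarrow> S \<subseteq> V \<and> (\<forall>u\<in>S. \<forall>v\<in>S. {u, v} \<notin> E)"

text \<open>A \<open>k\<close>-tuple of vertex sets is a function on indices, of which only the values on
  \<open>{1..k}\<close> matter.\<close>

definition is_coloring :: "'a set \<Rightarrow> 'a set set \<Rightarrow> nat \<Rightarrow> (nat \<Rightarrow> 'a set) \<Rightarrow> bool" where
  "is_coloring V E k C \<longleftrightarrow>
     (\<Union>i\<in>{1..k}. C i) = V \<and> disjoint_family_on C {1..k} \<and>
     (\<forall>i\<in>{1..k}. independent_set V E (C i))"

definition EQ1 :: "('a \<Rightarrow> rat) \<Rightarrow> nat \<Rightarrow> (nat \<Rightarrow> 'a set) \<Rightarrow> bool" where
  "EQ1 w k C \<longleftrightarrow>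
     (\<forall>i\<in>{1..k}. \<forall>j\<in>{1..k}. C i \<noteq> {} \<longrightarrow>
        (\<exists>v\<in>C i. sum w (C i - {v}) \<le> sum w (C j)))"

section \<open>A random access machine with logarithmic cost\<close>

text \<open>Structured programs over finitely many unbounded arrays of natural numbers. Each operation
  is charged the binary lengths of the numbers it handles, array indices included, so that running
  time is polynomially related to that of Turing machines. Subtraction is truncated.\<close>

type_synonym state = "nat \<Rightarrow> nat \<Rightarrow> nat"

datatype aexp =
    Const nat
  | Arr nat aexp
  | Plus aexp aexp
  | Minus aexp aexp
  | Times aexp aexp

datatype bexp =
    Less aexp aexp
  | BNot bexp
  | BAnd bexp bexp

datatype com =
    Skip
  | Assign nat aexp aexp
  | Seq com com
  | Cond bexp com com
  | While bexp com

definition bits :: "nat \<Rightarrow> nat" where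
  "bits n = floor_log n + 1"

fun aval :: "aexp \<Rightarrow> state \<Rightarrow> nat" where
  "aval (Const c) s = c"
| "aval (Arr x i) s = s x (aval i s)"
| "aval (Plus a b) s = aval a s + aval b s"
| "aval (Minus a b) s = aval a s - aval b s"
| "aval (Times a b) s = aval a s * aval b s"

fun acost :: "aexp \<Rightarrow> state \<Rightarrow> nat" where
  "acost (Const c) s = bits c"
| "acost (Arr x i) s = acost i s + bits (aval i s) + bits (s x (aval i s))"
| "acost (Plus a b) s = acost a s + acost b s + bits (aval a s) + bits (aval b s)"
| "acost (Minus a b) s = acost a s + acost b s + bits (aval a s) + bits (aval b s)"
| "acost (Times a b) s = acost a s + acost b s + bits (aval a s) + bits (aval b s)"

fun bval :: "bexp \<Rightarrow> state \<Rightarrow> bool" where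
  "bval (Less a b) s = (aval a s < aval b s)"
| "bval (BNot b) s = (\<not> bval b s)"
| "bval (BAnd b c) s = (bval b s \<and> bval c s)"

fun bcost :: "bexp \<Rightarrow> state \<Rightarrow> nat" where
  "bcost (Less a b) s = acost a s + acost b s + bits (aval a s) + bits (aval b s)"
| "bcost (BNot b) s = bcost b s + 1"
| "bcost (BAnd b c) s = bcost b s + bcost c s + 1"

text \<open>\<open>exec c s t s'\<close>: started in \<open>s\<close>, the program \<open>c\<close> halts in \<open>s'\<close> after time \<open>t\<close>.\<close>

inductive exec :: "com \<Rightarrow> state \<Rightarrow> nat \<Rightarrow> state \<Rightarrow> bool" where
  Skip: "exec Skip s 1 s"
| Assign: "exec (Assign x i a) s
     (acost i s + acost a s + bits (aval i s) + bits (aval a s))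
     (s(x := (s x)(aval i s := aval a s)))"
| Seq: "\<lbrakk>exec c1 s t1 s'; exec c2 s' t2 s''\<rbrakk> \<Longrightarrow> exec (Seq c1 c2) s (t1 + t2) s''"
| CondTrue: "\<lbrakk>bval b s; exec c1 s t s'\<rbrakk> \<Longrightarrow> exec (Cond b c1 c2) s (bcost b s + t) s'"
| CondFalse: "\<lbrakk>\<not> bval b s; exec c2 s t s'\<rbrakk> \<Longrightarrow> exec (Cond b c1 c2) s (bcost b s + t) s'"
| WhileFalse: "\<not> bval b s \<Longrightarrow> exec (While b c) s (bcost b s) s"
| WhileTrue: "\<lbrakk>bval b s; exec c s t1 s'; exec (While b c) s' t2 s''\<rbrakk> \<Longrightarrow>
     exec (While b c) s (bcost b s + t1 + t2) s''"

inductive_cases SkipE: "exec Skip s t s'"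
inductive_cases AssignE: "exec (Assign x i a) s t s'"
inductive_cases SeqE: "exec (Seq c1 c2) s t s'"
inductive_cases CondE: "exec (Cond b c1 c2) s t s'"
inductive_cases WhileE: "exec (While b c) s t s'"

lemma exec_deterministic:
  "exec c s t s' \<Longrightarrow> exec c s u s'' \<Longrightarrow> t = u \<and> s' = s''"
proof (induction arbitrary: u s'' rule: exec.induct)
  case (Skip s)
  then show ?case by (auto elim: SkipE)
next
  case (Assign x i a s)
  then show ?case by (auto elim: AssignE)
next
  case (Seq c1 s t1 s' c2 t2 s'')
  from Seq.prems show ?case
    by (rule SeqE) (use Seq.IH in blast)
next
  case (CondTrue b s c1 t s' c2)
  from CondTrue.prems show ?case
    by (rule CondE) (use CondTrue in blast)+
next
  case (CondFalse b s c2 t s' c1)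
  from CondFalse.prems show ?case
    by (rule CondE) (use CondFalse in blast)+
next
  case (WhileFalse b s c)
  from WhileFalse.prems show ?case
    by (rule WhileE) (use WhileFalse in auto)
next
  case (WhileTrue b s c t1 s' t2 s'')
  from WhileTrue.prems show ?case
    by (rule WhileE) (use WhileTrue in blast)+
qed

text \<open>The input is a list of lists of words, the \<open>j\<close>-th of which is loaded into array \<open>j + 1\<close>;
  all other cells are initially 0. Array 0 is the output.\<close>

definition load :: "nat list list \<Rightarrow> state" where
  "load xss a i = (case a of 0 \<Rightarrow> 0
     | Suc j \<Rightarrow> if j < length xss \<and> i < length (xss ! j) then xss ! j ! i else 0)"

definition input_size :: "nat list list \<Rightarrow> nat" where
  "input_size xss = sum_list (map bits (concat xss))"

text \<open>One program and one polynomial serve for all instances in \<open>I\<close>; \<open>enc\<close> encodes instances, and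
  \<open>R x out\<close> says that the array \<open>out\<close> is a correct output for \<open>x\<close>.\<close>

definition polytime_solvable ::
  "'i set \<Rightarrow> ('i \<Rightarrow> nat list list) \<Rightarrow> ('i \<Rightarrow> (nat \<Rightarrow> nat) \<Rightarrow> bool) \<Rightarrow> bool" where
  "polytime_solvable I enc R \<longleftrightarrow>
     (\<exists>c (p :: nat poly). \<forall>x\<in>I. \<exists>t s.
        exec c (load (enc x)) t s \<and> t \<le> poly p (input_size (enc x)) \<and> R x (s 0))"

section \<open>Encoding of instances\<close>

text \<open>For computation, the vertices are \<open>0, \<dots>, n - 1\<close>. The graph is given by its adjacency matrix,
  row by row, and the weights by numerators and denominators in lowest terms.\<close>

definition encode :: "nat \<times> nat set set \<times> (nat \<Rightarrow> rat) \<times> nat \<Rightarrow> nat list list" where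
  "encode = (\<lambda>(n, E, w, k).
     [[n, k],
      map (\<lambda>i. of_bool ({i div n, i mod n} \<in> E)) [0..<n * n],
      map (\<lambda>v. nat (fst (quotient_of (w v)))) [0..<n],
      map (\<lambda>v. nat (snd (quotient_of (w v)))) [0..<n]])"

definition color_classes :: "nat \<Rightarrow> (nat \<Rightarrow> nat) \<Rightarrow> nat \<Rightarrow> nat set" where
  "color_classes n f i = {v \<in> {..<n}. f v = i}"

end

theory Submission
  imports Defs
begin

text \<open>Rank the vertices by decreasing weight and cut the ranking into blocks of \<open>k\<close>. If every color
  class contains one vertex of each block, then, after removal of its heaviest vertex, a class is
  dominated by every other class, so the coloring is EQ1. Blocks within a single weight need not be
  told apart, so they are merged into one group; a group of \<open>q\<close> merged blocks has capacity
  \<open>q\<close> in every class, and there are at most \<open>3d\<close> groups.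

  Vertices are inserted in order of increasing capacity of their groups. To insert \<open>v\<close> of
  capacity \<open>q\<close>, pick a color \<open>i\<close> where the group of \<open>v\<close> is not full. If \<open>v\<close> is adjacent to
  every such color, let it replace a vertex \<open>u\<close> of its group, and move \<open>u\<close> to \<open>i\<close>. At least
  \<open>(k - \<Delta>) q\<close> vertices of the group have a color that is free for \<open>v\<close>, while the class
  \<open>i\<close> has at most \<open>3d q\<close> vertices and so at most \<open>3d q \<Delta>\<close> neighbours; hence \<open>u\<close> exists as
  soon as \<open>k > (3d + 1) \<Delta>\<close>. This is also the algorithm, except that for \<open>k \<ge> n\<close> all vertices
  simply get different colors.\<close>

section \<open>Programs with counting loops\<close>

definition upd :: "state \<Rightarrow> nat \<Rightarrow> nat \<Rightarrow> nat \<Rightarrow> state" where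
  "upd s x i v = s(x := (s x)(i := v))"

lemma upd_same: "upd s x i v x = (s x)(i := v)"
  by (simp add: upd_def)

lemma upd_other: "y \<noteq> x \<Longrightarrow> upd s x i v y = s y"
  by (simp add: upd_def)

text \<open>Every loop \<open>For x p\<close> runs \<open>x[0]\<close> through \<open>0, \<dots>, n - 1\<close>, where \<open>n\<close> is the first
  input word, found in cell 0 of array 1.\<close>

datatype prog =
    Nop
  | Do nat aexp aexp
  | Then prog prog
  | If bexp prog prog
  | For nat prog

primrec compile :: "prog \<Rightarrow> com" where
  "compile Nop = Skip"
| "compile (Do x i a) = Assign x i a"
| "compile (Then p q) = Seq (compile p) (compile q)"
| "compile (If b p q) = Cond b (compile p) (compile q)"
| "compile (For x p) = Seq (Assign x (Const 0) (Const 0))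
     (While (Less (Arr x (Const 0)) (Arr 1 (Const 0)))
       (Seq (compile p) (Assign x (Const 0) (Plus (Arr x (Const 0)) (Const 1)))))"

text \<open>A loop becomes an iterate of fixed length, so \<open>den\<close> is total and
  termination needs no argument at this level. It agrees with the compiled \<open>While\<close> if
  the body writes neither the loop variable nor array 1, as \<open>well_formed\<close>
  demands.\<close>

primrec den :: "prog \<Rightarrow> state \<Rightarrow> state" where
  "den Nop = (\<lambda>s. s)"
| "den (Do x i a) = (\<lambda>s. upd s x (aval i s) (aval a s))"
| "den (Then p q) = (\<lambda>s. den q (den p s))"
| "den (If b p q) = (\<lambda>s. if bval b s then den p s else den q s)"
| "den (For x p) = (\<lambda>s.
     ((\<lambda>s. upd (den p s) x 0 (den p s x 0 + 1)) ^^ (s 1 0)) (upd s x 0 0))"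

primrec writes :: "prog \<Rightarrow> nat set" where
  "writes Nop = {}"
| "writes (Do x i a) = {x}"
| "writes (Then p q) = writes p \<union> writes q"
| "writes (If b p q) = writes p \<union> writes q"
| "writes (For x p) = insert x (writes p)"

fun slow :: "aexp \<Rightarrow> bool" where
  "slow (Const c) \<longleftrightarrow> c \<le> 1"
| "slow (Arr x i) \<longleftrightarrow> True"
| "slow (Plus (Arr x i) (Const c)) \<longleftrightarrow> c \<le> 1"
| "slow _ \<longleftrightarrow> False"

text \<open>A stored value exceeds the existing ones by at most 1, so that numbers stay small however
  often a loop is repeated.\<close>

primrec well_formed :: "prog \<Rightarrow> bool" where
  "well_formed Nop \<longleftrightarrow> True"
| "well_formed (Do x i a) \<longleftrightarrow> x \<noteq> 1 \<and> slow a"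
| "well_formed (Then p q) \<longleftrightarrow> well_formed p \<and> well_formed q"
| "well_formed (If b p q) \<longleftrightarrow> well_formed p \<and> well_formed q"
| "well_formed (For x p) \<longleftrightarrow> x \<noteq> 1 \<and> x \<notin> writes p \<and> well_formed p"

lemma den_frame: "a \<notin> writes p \<Longrightarrow> den p s a = s a"
proof (induction p arbitrary: s)
  case (For x p)
  have "((\<lambda>s. upd (den p s) x 0 (den p s x 0 + 1)) ^^ m) s a = s a" for m s
    by (induction m) (use For in \<open>auto simp: upd_def\<close>)
  with For.prems show ?case by (simp add: upd_def)
qed (auto simp: upd_def)

lemma well_formed_size_unwritten: "well_formed p \<Longrightarrow> 1 \<notin> writes p"
  by (induction p) auto

text \<open>Wherever the invariant has to be shown, the counter holds an arbitrary \<open>j\<close>,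
  so an invariant need not track the loop variable; the body may still rely on
  \<open>r x 0 = i\<close>.\<close>

lemma den_For_invariant:
  assumes wf: "well_formed (For x p)"
    and base: "\<And>j. I 0 (upd s x 0 j)"
    and step: "\<And>i r j. \<lbrakk>i < s 1 0; I i r; r x 0 = i\<rbrakk> \<Longrightarrow> I (Suc i) (upd (den p r) x 0 j)"
  shows "I (s 1 0) (den (For x p) s)"
proof -
  let ?f = "\<lambda>s. upd (den p s) x 0 (den p s x 0 + 1)"
  have "m \<le> s 1 0 \<Longrightarrow> I m ((?f ^^ m) (upd s x 0 0)) \<and> (?f ^^ m) (upd s x 0 0) x 0 = m" for m
  proof (induction m)
    case 0
    have "upd s x 0 0 x 0 = 0" by (simp add: upd_same)
    with base[of 0] show ?case by (simp only: funpow_0)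
  next
    case (Suc m)
    define r where "r = (?f ^^ m) (upd s x 0 0)"
    from Suc have r: "I m r" "r x 0 = m" "m < s 1 0" by (simp_all add: r_def)
    then have "I (Suc m) (?f r)" by (intro step)
    moreover have "?f r x 0 = Suc m"
      using wf r den_frame[of x p] by (simp add: upd_same)
    ultimately show ?case by (simp only: funpow.simps o_apply r_def)
  qed
  then show ?thesis by simp
qed

section \<open>Running time\<close>

text \<open>Coefficients read off the syntax: if every cell has bit length at most
  \<open>\<beta>\<close>, multiplying by \<open>\<beta>\<close> yields the bound. Operands
  contribute additively because \<open>bits\<close> is subadditive under sums and products
  alike.\<close>

primrec value_size :: "aexp \<Rightarrow> nat" where
  "value_size (Const c) = bits c"
| "value_size (Arr x i) = 1"
| "value_size (Plus a b) = value_size a + value_size b"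
| "value_size (Minus a b) = value_size a + value_size b"
| "value_size (Times a b) = value_size a + value_size b"

primrec aexp_size :: "aexp \<Rightarrow> nat" where
  "aexp_size (Const c) = bits c"
| "aexp_size (Arr x i) = aexp_size i + value_size i + 1"
| "aexp_size (Plus a b) = aexp_size a + aexp_size b + value_size a + value_size b"
| "aexp_size (Minus a b) = aexp_size a + aexp_size b + value_size a + value_size b"
| "aexp_size (Times a b) = aexp_size a + aexp_size b + value_size a + value_size b"

primrec bexp_size :: "bexp \<Rightarrow> nat" where
  "bexp_size (Less a b) = aexp_size a + aexp_size b + value_size a + value_size b"
| "bexp_size (BNot b) = bexp_size b + 1"
| "bexp_size (BAnd b c) = bexp_size b + bexp_size c + 1"

lemma bits_pos: "1 \<le> bits n"
  by (simp add: bits_def)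

lemma bits_mono: "m \<le> n \<Longrightarrow> bits m \<le> bits n"
  by (simp add: bits_def floor_log_le_iff)

lemma less_two_power_bits: "n < 2 ^ bits n"
  by (cases "n = 0") (simp_all add: bits_def floor_log_exp2_gt)

lemma bits_le: "n < 2 ^ m \<Longrightarrow> 1 \<le> m \<Longrightarrow> bits n \<le> m"
proof -
  assume n: "n < 2 ^ m" and m: "1 \<le> m"
  show "bits n \<le> m"
  proof (cases "n = 0")
    case True
    then show ?thesis using m by (simp add: bits_def)
  next
    case False
    then have "2 ^ floor_log n \<le> n" using floor_log_exp2_le by simp
    with n have "(2::nat) ^ floor_log n < 2 ^ m" by linarith
    then show ?thesis by (simp add: bits_def)
  qed
qed

lemma bits_mult: "bits (m * n) \<le> bits m + bits n"
proof (rule bits_le)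
  show "m * n < 2 ^ (bits m + bits n)"
    unfolding power_add by (intro mult_strict_mono' less_two_power_bits) auto
qed (use bits_pos[of m] in simp)

lemma bits_add: "bits (m + n) \<le> bits m + bits n"
proof (rule bits_le)
  have a: "m + 1 \<le> 2 ^ bits m" "n + 1 \<le> 2 ^ bits n"
    using less_two_power_bits Suc_leI by (simp_all add: Suc_leI)
  \<comment> \<open>Passing to the product of the successors makes the exponents add.\<close>
  have "m + n < (m + 1) * (n + 1)" by simp
  also have "\<dots> \<le> 2 ^ (bits m + bits n)"
    unfolding power_add by (intro mult_mono a) auto
  finally show "m + n < 2 ^ (bits m + bits n)" .
qed (use bits_pos[of m] in simp)

lemma bits_le_Suc: "bits n \<le> n + 1"
proof -
  have "n < 2 ^ (n + 1)" by (induction n) auto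
  then show ?thesis by (intro bits_le) auto
qed

context
  fixes s :: state and \<beta> :: nat
  assumes bounded: "\<And>a i. bits (s a i) \<le> \<beta>"
begin

lemma bits_aval: "bits (aval e s) \<le> value_size e * \<beta>"
proof (induction e)
  have \<beta>: "1 \<le> \<beta>" using bounded[of 0 0] bits_pos le_trans by blast
  case (Const c)
  then show ?case using \<beta> by simp
next
  case (Arr x i)
  then show ?case by (simp add: bounded)
next
  case (Plus a b)
  then show ?case using bits_add[of "aval a s" "aval b s"] by (simp add: algebra_simps)
next
  case (Minus a b)
  then show ?case using bits_mono[of "aval a s - aval b s" "aval a s"]
    by (simp add: algebra_simps)
next
  case (Times a b)
  then show ?case using bits_mult[of "aval a s" "aval b s"] by (simp add: algebra_simps)
qed

lemma acost_le: "acost e s \<le> aexp_size e * \<beta>"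
proof (induction e)
  have \<beta>: "1 \<le> \<beta>" using bounded[of 0 0] bits_pos le_trans by blast
  case (Const c)
  then show ?case using \<beta> by simp
next
  case (Arr x i)
  then show ?case using bits_aval[of i] bounded[of x "aval i s"]
    by (simp add: algebra_simps)
next
  case (Plus a b)
  then show ?case using bits_aval[of a] bits_aval[of b] by (simp add: algebra_simps)
next
  case (Minus a b)
  then show ?case using bits_aval[of a] bits_aval[of b] by (simp add: algebra_simps)
next
  case (Times a b)
  then show ?case using bits_aval[of a] bits_aval[of b] by (simp add: algebra_simps)
qed

lemma bcost_le: "bcost e s \<le> bexp_size e * \<beta>"
proof -
  have \<beta>: "1 \<le> \<beta>" using bounded[of 0 0] bits_pos le_trans by blast
  show ?thesis
  proof (induction e)
    case (Less a b)
    then show ?case using bits_aval[of a] bits_aval[of b] acost_le[of a] acost_le[of b]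
      by (simp add: algebra_simps)
  qed (use \<beta> in \<open>simp_all add: algebra_simps\<close>)
qed

end

text \<open>With \<open>n\<close> iterations per loop, \<open>work p\<close> evaluated at \<open>n\<close> bounds both the growth of the
  stored numbers and the running time relative to their bit length.\<close>

definition loop_overhead :: nat where
  "loop_overhead = 20"

primrec work :: "prog \<Rightarrow> nat poly" where
  "work Nop = [:1:]"
| "work (Do x i a) = [:aexp_size i + aexp_size a + value_size i + value_size a + 1:]"
| "work (Then p q) = work p + work q"
| "work (If b p q) = [:bexp_size b:] + work p + work q"
| "work (For x p) = [:2 * loop_overhead:] + [:0, 1:] * (work p + [:2 * loop_overhead:])"

lemma slow_aval: "slow a \<Longrightarrow> (\<And>x i. s x i \<le> M) \<Longrightarrow> aval a s \<le> M + 1"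
  by (induction a rule: slow.induct) (auto intro: le_SucI, metis add_mono add_Suc_right add.right_neutral)

section \<open>Compiled programs run within the bound\<close>

definition runs :: "com \<Rightarrow> state \<Rightarrow> nat \<Rightarrow> state \<Rightarrow> bool" where
  "runs c s T s' \<longleftrightarrow> (\<exists>t\<le>T. exec c s t s')"

lemma runs_Seq: "runs c s T s' \<Longrightarrow> runs d s' U s'' \<Longrightarrow> T + U \<le> W \<Longrightarrow> runs (Seq c d) s W s''"
  unfolding runs_def by (meson add_mono exec.Seq le_trans)

lemma runs_Assign:
  assumes "\<And>a i. bits (s a i) \<le> \<beta>"
    and "(aexp_size i + aexp_size a + value_size i + value_size a) * \<beta> \<le> T"
  shows "runs (Assign x i a) s T (upd s x (aval i s) (aval a s))"
proof -
  have "acost i s + acost a s + bits (aval i s) + bits (aval a s) \<le>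
     (aexp_size i + aexp_size a + value_size i + value_size a) * \<beta>"
    unfolding add_mult_distrib
    by (intro add_mono acost_le bits_aval assms(1))
  then show ?thesis
    using exec.Assign[of x i a s] assms(2) unfolding runs_def upd_def by (meson le_trans)
qed

text \<open>The bound on stored numbers rises by \<open>W + 1\<close> per iteration, whereas
  \<open>\<beta>\<close> is fixed for the entire loop. Hence \<open>body\<close> is assumed for
  every \<open>M\<close> that still fits, and the last premise on \<open>s\<close> leaves room for
  all \<open>r\<close> iterations.\<close>

lemma runs_While:
  assumes x: "x \<noteq> 1" "x \<notin> writes p" "1 \<notin> writes p"
    and body: "\<And>s M. (\<And>a i. s a i \<le> M) \<Longrightarrow> s 1 0 = n \<Longrightarrow> bits (M + W) \<le> \<beta> \<Longrightarrow>
      runs (compile p) s (W * \<beta>) (den p s) \<and> (\<forall>a i. den p s a i \<le> M + W)"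
    and s: "s x 0 + r = n" "s 1 0 = n" "\<And>a i. s a i \<le> M" "bits (M + r * (W + 1)) \<le> \<beta>"
  defines "f \<equiv> \<lambda>s. upd (den p s) x 0 (den p s x 0 + 1)"
  shows "runs (While (Less (Arr x (Const 0)) (Arr 1 (Const 0)))
       (Seq (compile p) (Assign x (Const 0) (Plus (Arr x (Const 0)) (Const 1)))))
     s ((loop_overhead + r * (W + 2 * loop_overhead)) * \<beta>) ((f ^^ r) s) \<and>
     (\<forall>a i. (f ^^ r) s a i \<le> M + r * (W + 1))"
  using s
proof (induction r arbitrary: s M)
  let ?b = "Less (Arr x (Const 0)) (Arr 1 (Const 0))"
  \<comment> \<open>As \<open>bits 0 = bits 1 = 1\<close>, the coefficient of the guard is 8; that
    of the increment is 10 and that of the initial assignment is 4. The constant 20 covers each of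
    them.\<close>
  have size: "bexp_size ?b \<le> loop_overhead"
    by (simp add: loop_overhead_def bits_def)
  {
    case 0
    have "\<And>a i. bits (s a i) \<le> \<beta>" using 0 bits_mono by (metis add_0_right le_trans mult_0)
    then have "bcost ?b s \<le> bexp_size ?b * \<beta>" by (rule bcost_le)
    also have "\<dots> \<le> loop_overhead * \<beta>" using size by (rule mult_right_mono) simp
    finally have "runs (While ?b (Seq (compile p) (Assign x (Const 0) (Plus (Arr x (Const 0)) (Const 1)))))
      s (loop_overhead * \<beta>) s"
      using exec.WhileFalse[of ?b s] 0 unfolding runs_def by auto
    then show ?case using 0 by simp
  next
    case (Suc r)
    have small: "bits (M + W) \<le> \<beta>" "bits M \<le> \<beta>"
      using Suc.prems(4) bits_mono[of "M + W" "M + Suc r * (W + 1)"]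
        bits_mono[of "M" "M + Suc r * (W + 1)"] by auto
    have d: "runs (compile p) s (W * \<beta>) (den p s)" "\<And>a i. den p s a i \<le> M + W"
      using body[OF Suc.prems(3) _ small(1)] Suc.prems(2) by auto
    have fr: "den p s x = s x" "den p s 1 = s 1" using x den_frame by auto
    have "bits (den p s a i) \<le> \<beta>" for a i
      using bits_mono[OF d(2)] small(1) le_trans by blast
    from runs_Assign[OF this, of "Const 0" "Plus (Arr x (Const 0)) (Const 1)"
        "loop_overhead * \<beta>" x]
    have "runs (Assign x (Const 0) (Plus (Arr x (Const 0)) (Const 1))) (den p s)
       (loop_overhead * \<beta>) (f s)"
      by (simp add: f_def loop_overhead_def bits_def)
    with d(1) have body': "runs (Seq (compile p) (Assign x (Const 0) (Plus (Arr x (Const 0)) (Const 1))))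
        s (W * \<beta> + loop_overhead * \<beta>) (f s)"
      by (rule runs_Seq) simp
    have fb: "f s a i \<le> M + W + 1" for a i
      using d(2)[of a i] d(2)[of x 0] by (auto simp: f_def upd_def)
    have fx: "f s x 0 + r = n" "f s 1 0 = n"
      using Suc.prems x fr by (auto simp: f_def upd_def)
    have IH: "runs (While ?b (Seq (compile p) (Assign x (Const 0) (Plus (Arr x (Const 0)) (Const 1)))))
        (f s) ((loop_overhead + r * (W + 2 * loop_overhead)) * \<beta>) ((f ^^ r) (f s)) \<and>
      (\<forall>a i. (f ^^ r) (f s) a i \<le> (M + W + 1) + r * (W + 1))"
      by (rule Suc.IH[where s = "f s" and M = "M + W + 1", OF fx fb]) (use Suc.prems(4) in \<open>simp add: algebra_simps\<close>)
    have "bits (s a i) \<le> \<beta>" for a i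
      using Suc.prems(3) small(2) bits_mono le_trans by blast
    then have "bcost ?b s \<le> bexp_size ?b * \<beta>" by (rule bcost_le)
    also have "\<dots> \<le> loop_overhead * \<beta>" using size by (rule mult_right_mono) simp
    finally have bc: "bcost ?b s \<le> loop_overhead * \<beta>" .
    have bv: "bval ?b s" using Suc.prems by simp
    obtain t1 where t1: "exec (Seq (compile p) (Assign x (Const 0) (Plus (Arr x (Const 0)) (Const 1)))) s t1 (f s)"
      "t1 \<le> W * \<beta> + loop_overhead * \<beta>"
      using body' by (auto simp: runs_def)
    obtain t2 where t2: "exec (While ?b (Seq (compile p) (Assign x (Const 0) (Plus (Arr x (Const 0)) (Const 1)))))
        (f s) t2 ((f ^^ r) (f s))" "t2 \<le> (loop_overhead + r * (W + 2 * loop_overhead)) * \<beta>"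
      using IH by (auto simp: runs_def)
    have "bcost ?b s + t1 + t2 \<le> (loop_overhead + Suc r * (W + 2 * loop_overhead)) * \<beta>"
      using bc t1(2) t2(2) by (simp add: algebra_simps)
    with exec.WhileTrue[OF bv t1(1) t2(1)] IH show ?case
      unfolding runs_def funpow_Suc_right o_def by (auto simp: algebra_simps)
  }
qed

text \<open>\<open>\<beta>\<close> bounds the length of \<open>M\<close> plus the total growth,
  hence of all numbers met on the way, and each elementary cost is a constant multiple of it. Array
  1 is never written, so all polynomials are evaluated at the same number.\<close>

lemma runs_compile:
  assumes "well_formed p" "\<And>a i. s a i \<le> M" "bits (M + poly (work p) (s 1 0)) \<le> \<beta>"
  shows "runs (compile p) s (poly (work p) (s 1 0) * \<beta>) (den p s) \<and>
    (\<forall>a i. den p s a i \<le> M + poly (work p) (s 1 0))"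
  using assms
proof (induction p arbitrary: s M)
  case Nop
  have "1 \<le> \<beta>" using Nop bits_pos le_trans by blast
  then show ?case using Nop exec.Skip[of s] by (auto simp: runs_def intro: le_SucI)
next
  case (Do x i a)
  have "bits (s a i) \<le> \<beta>" for a i
    using Do.prems bits_mono le_trans by (meson le_add1)
  then have runs: "runs (Assign x i a) s (poly (work (Do x i a)) (s 1 0) * \<beta>)
     (upd s x (aval i s) (aval a s))"
    by (rule runs_Assign) simp
  have "aval a s \<le> M + 1" using Do.prems slow_aval by simp
  moreover have "s b j \<le> M + (c + 1)" for b j c
    using Do.prems(2)[of b j] by simp
  ultimately have "upd s x (aval i s) (aval a s) b j \<le> M + poly (work (Do x i a)) (s 1 0)" for b j
    by (auto simp: upd_def)
  with runs show ?case by simp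
next
  case (Then p q)
  have n: "den p s 1 0 = s 1 0"
    using Then.prems(1) den_frame[OF well_formed_size_unwritten, of p] by simp
  have p: "runs (compile p) s (poly (work p) (s 1 0) * \<beta>) (den p s) \<and>
    (\<forall>a i. den p s a i \<le> M + poly (work p) (s 1 0))"
    using Then.prems bits_mono[of "M + poly (work p) (s 1 0)" "M + poly (work (Then p q)) (s 1 0)"]
    by (intro Then.IH) auto
  have q: "runs (compile q) (den p s) (poly (work q) (den p s 1 0) * \<beta>) (den q (den p s)) \<and>
    (\<forall>a i. den q (den p s) a i \<le> (M + poly (work p) (s 1 0)) + poly (work q) (den p s 1 0))"
    using Then.prems p n by (intro Then.IH) (auto simp: add.assoc)
  have "runs (Seq (compile p) (compile q)) s (poly (work (Then p q)) (s 1 0) * \<beta>) (den q (den p s))"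
    using p q n by (auto intro!: runs_Seq[of "compile p" s _ "den p s" "compile q"] simp: algebra_simps)
  then show ?case using q n by (simp add: add.assoc)
next
  case (If b p q)
  have "bits (s a i) \<le> \<beta>" for a i
    using If.prems bits_mono le_trans by (meson le_add1)
  then have bc: "bcost b s \<le> bexp_size b * \<beta>" by (rule bcost_le)
  have "runs (compile p) s (poly (work p) (s 1 0) * \<beta>) (den p s) \<and>
    (\<forall>a i. den p s a i \<le> M + poly (work p) (s 1 0))"
    using If.prems bits_mono[of "M + poly (work p) (s 1 0)" "M + poly (work (If b p q)) (s 1 0)"]
    by (intro If.IH) auto
  moreover have "runs (compile q) s (poly (work q) (s 1 0) * \<beta>) (den q s) \<and>
    (\<forall>a i. den q s a i \<le> M + poly (work q) (s 1 0))"
    using If.prems bits_mono[of "M + poly (work q) (s 1 0)" "M + poly (work (If b p q)) (s 1 0)"]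
    by (intro If.IH) auto
  ultimately obtain t u where t: "exec (compile p) s t (den p s)" "t \<le> poly (work p) (s 1 0) * \<beta>"
     "\<forall>a i. den p s a i \<le> M + poly (work p) (s 1 0)"
    and u: "exec (compile q) s u (den q s)" "u \<le> poly (work q) (s 1 0) * \<beta>"
     "\<forall>a i. den q s a i \<le> M + poly (work q) (s 1 0)"
    by (auto simp: runs_def)
  show ?case
  proof (cases "bval b s")
    case True
    have "bcost b s + t \<le> poly (work (If b p q)) (s 1 0) * \<beta>"
      using bc t(2) by (simp add: algebra_simps)
    moreover have "den p s a i \<le> M + poly (work (If b p q)) (s 1 0)" for a i
      using t(3)[rule_format, of a i] by simp
    ultimately show ?thesis
      using exec.CondTrue[OF True t(1)] True unfolding runs_def by auto
  next
    case False
    have "bcost b s + u \<le> poly (work (If b p q)) (s 1 0) * \<beta>"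
      using bc u(2) by (simp add: algebra_simps)
    moreover have "den q s a i \<le> M + poly (work (If b p q)) (s 1 0)" for a i
      using u(3)[rule_format, of a i] by simp
    ultimately show ?thesis
      using exec.CondFalse[OF False u(1)] False unfolding runs_def by auto
  qed
next
  case (For x p)
  let ?n = "s 1 0" and ?W = "poly (work p) (s 1 0)"
  have pw: "poly (work (For x p)) ?n =
      2 * loop_overhead + ?n * (?W + 2 * loop_overhead)" by simp
  have x: "x \<noteq> 1" "x \<notin> writes p" "1 \<notin> writes p"
    using For.prems(1) well_formed_size_unwritten[of p] by auto
  have body: "runs (compile p) r (?W * \<beta>) (den p r) \<and> (\<forall>a i. den p r a i \<le> N + ?W)"
    if "\<And>a i. r a i \<le> N" "r 1 0 = ?n" "bits (N + ?W) \<le> \<beta>" for r N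
    using For.IH[of r N] that For.prems(1) by auto
  have small: "M + ?n * (?W + 1) \<le> M + poly (work (For x p)) ?n"
    unfolding pw by (intro add_left_mono trans_le_add2 mult_left_mono)
      (auto simp: loop_overhead_def)
  have M: "upd s x 0 0 a i \<le> M" for a i using For.prems(2) by (simp add: upd_def)
  have "bits (M + ?n * (?W + 1)) \<le> \<beta>"
    using bits_mono[OF small] For.prems(3) by linarith
  note loop = runs_While[where s = "upd s x 0 0" and r = "?n" and n = "?n" and W = ?W and M = M,
      OF x body _ _ M this]
  have "upd s x 0 0 x 0 + ?n = ?n" "upd s x 0 0 1 0 = ?n"
    using x by (simp_all add: upd_def)
  note loop = loop[OF _ _ _ this]
  have b: "bits (s a i) \<le> \<beta>" for a i
    using For.prems bits_mono le_trans by (meson le_add1)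
  have "runs (Assign x (Const 0) (Const 0)) s (loop_overhead * \<beta>) (upd s x 0 0)"
    using runs_Assign[OF b, of "Const 0" "Const 0" "loop_overhead * \<beta>" x]
    by (simp add: loop_overhead_def bits_def)
  then have "runs (compile (For x p)) s (poly (work (For x p)) ?n * \<beta>) (den (For x p) s)"
    unfolding compile.simps den.simps pw
    by (rule runs_Seq[OF _ conjunct1[OF loop]]) (simp_all add: algebra_simps)
  moreover have "den (For x p) s a i \<le> M + poly (work (For x p)) ?n" for a i
    unfolding den.simps using conjunct2[OF loop] small le_trans by blast
  ultimately show ?case by blast
qed

section \<open>Polynomial time in the input size\<close>

lemma entry_bits_le_input_size:
  assumes "0 < input_size xss"
  shows "bits (load xss a i) \<le> input_size xss"
proof -
  have "load xss a i = 0 \<or> load xss a i \<in> set (concat xss)"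
  proof (cases a)
    case (Suc j)
    have "xss ! j ! i \<in> set (concat xss)" if "j < length xss" "i < length (xss ! j)"
      using nth_mem[OF that(1)] nth_mem[OF that(2)] by auto
    then show ?thesis by (simp add: Suc load_def)
  qed (simp add: load_def)
  then show ?thesis
  proof
    \<comment> \<open>A cell outside the input holds 0, whose length is 1.\<close>
    assume "load xss a i = 0"
    then show ?thesis using assms by (simp add: bits_def)
  next
    assume "load xss a i \<in> set (concat xss)"
    then show ?thesis unfolding input_size_def
      by (intro member_le_sum_list) auto
  qed
qed

lemma poly_nat_mono: "m \<le> n \<Longrightarrow> poly p m \<le> poly p n" for p :: "nat poly"
  by (induction p) (auto intro: add_mono mult_mono)

text \<open>With \<open>z\<close> the input size, all loaded numbers are below \<open>2 ^ z\<close>,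
  and the run adds at most the work to them. Lengths therefore stay below \<open>z\<close> plus the
  work plus 1, and the product of this with the work is the polynomial \<open>?T\<close>.\<close>

lemma polytime_solvable_compile:
  assumes wf: "well_formed p"
    and size: "\<And>x. x \<in> I \<Longrightarrow> load (enc x) 1 0 \<le> input_size (enc x)"
    and nonempty: "\<And>x. x \<in> I \<Longrightarrow> 0 < input_size (enc x)"
    and correct: "\<And>x. x \<in> I \<Longrightarrow> R x (den p (load (enc x)) 0)"
  shows "polytime_solvable I enc R"
proof -
  let ?T = "work p * ([:1:] + [:0, 1:] + work p)"
  have "\<exists>t s. exec (compile p) (load (enc x)) t s \<and> t \<le> poly ?T (input_size (enc x)) \<and> R x (s 0)"
    if x: "x \<in> I" for x
  proof -
    let ?s = "load (enc x)" and ?z = "input_size (enc x)"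
    have entry: "?s a i \<le> 2 ^ ?z - 1" for a i
    proof -
      have "?s a i < 2 ^ bits (?s a i)" by (rule less_two_power_bits)
      also have "\<dots> \<le> 2 ^ ?z"
        using entry_bits_le_input_size nonempty x by (intro power_increasing) auto
      finally show ?thesis by simp
    qed
    let ?w = "poly (work p) (?s 1 0)"
    have w: "?w \<le> poly (work p) ?z" by (rule poly_nat_mono[OF size[OF x]])
    have "bits (2 ^ ?z - 1 + ?w) \<le> bits (2 ^ ?z - 1) + bits ?w" by (rule bits_add)
    also have "bits (2 ^ ?z - 1) \<le> ?z" using nonempty[OF x] by (intro bits_le) auto
    also have "bits ?w \<le> ?w + 1" by (rule bits_le_Suc)
    finally have "bits (2 ^ ?z - 1 + ?w) \<le> ?z + (?w + 1)" by simp
    from runs_compile[where p = p and s = ?s and M = "2 ^ ?z - 1", OF wf entry this]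
    obtain t where t: "exec (compile p) ?s t (den p ?s)" "t \<le> ?w * (?z + (?w + 1))"
      by (auto simp: runs_def)
    note t(2)
    also have "?w * (?z + (?w + 1)) \<le> poly (work p) ?z * (?z + (poly (work p) ?z + 1))"
      using w by (intro mult_mono add_mono) auto
    also have "\<dots> = poly ?T ?z" by simp
    finally show ?thesis using t(1) correct[OF x] by blast
  qed
  then show ?thesis unfolding polytime_solvable_def by blast
qed

section \<open>Inserting a vertex by a single exchange\<close>

lemma finite_edges: "simple_graph V E \<Longrightarrow> finite E"
proof -
  assume g: "simple_graph V E"
  then have "E \<subseteq> Pow V" by (auto simp: simple_graph_def)
  then show ?thesis using g by (auto simp: simple_graph_def intro: finite_subset)
qed

lemma card_neighbours_le:
  assumes "simple_graph V E"
  shows "card {x \<in> V. {v, x} \<in> E} \<le> vertex_degree E v"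
  unfolding vertex_degree_def
proof (rule card_inj_on_le[where f = "\<lambda>x. {v, x}"])
  show "inj_on (\<lambda>x. {v, x}) {x \<in> V. {v, x} \<in> E}"
    by (auto simp: inj_on_def doubleton_eq_iff)
qed (use finite_edges[OF assms] in auto)

text \<open>The insertion argument sees the groups only through these numbers. Here \<open>m\<close>
  bounds the number of groups, and \<open>group_size\<close> says that \<open>k\<close> colors with
  \<open>cap v\<close> places each have room for the group of \<open>v\<close>.\<close>

locale grouped_graph =
  fixes V :: "'a set" and E :: "'a set set" and k m \<Delta> :: nat
    and lab :: "'a \<Rightarrow> 'b" and cap :: "'a \<Rightarrow> nat"
  assumes graph: "simple_graph V E"
    and degree: "v \<in> V \<Longrightarrow> vertex_degree E v \<le> \<Delta>"
    and cap_lab: "u \<in> V \<Longrightarrow> v \<in> V \<Longrightarrow> lab u = lab v \<Longrightarrow> cap u = cap v"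
    and group_size: "v \<in> V \<Longrightarrow> card {u \<in> V. lab u = lab v} \<le> k * cap v"
    and labels: "card (lab ` V) \<le> m"
    and many_colors: "(m + 1) * \<Delta> < k"
begin

lemma finite_V: "finite V"
  using graph by (simp add: simple_graph_def)

lemma no_loop: "{v, v} \<notin> E"
  using graph by (force simp: simple_graph_def)

text \<open>Color 0 marks uncolored vertices.\<close>

definition feasible :: "('a \<Rightarrow> nat) \<Rightarrow> bool" where
  "feasible f \<longleftrightarrow> (\<forall>u\<in>V. f u \<le> k) \<and>
     (\<forall>u\<in>V. \<forall>v\<in>V. {u, v} \<in> E \<longrightarrow> f u \<noteq> 0 \<longrightarrow> f u \<noteq> f v) \<and>
     (\<forall>i\<in>{1..k}. \<forall>v\<in>V. card {x \<in> V. lab x = lab v \<and> f x = i} \<le> cap v)"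

text \<open>The vertex \<open>v\<close> takes over the color of \<open>u\<close>, which moves to the color \<open>i\<close>; for \<open>u = v\<close>
  the vertex \<open>v\<close> itself gets the color \<open>i\<close>.\<close>

definition insertable :: "('a \<Rightarrow> nat) \<Rightarrow> 'a \<Rightarrow> nat \<Rightarrow> 'a \<Rightarrow> bool" where
  "insertable f v i u \<longleftrightarrow> i \<in> {1..k} \<and> u \<in> V \<and>
     card {x \<in> V. lab x = lab v \<and> f x = i} < cap v \<and>
     (u = v \<or> f u \<noteq> 0 \<and> lab u = lab v \<and> (\<forall>x\<in>V. {v, x} \<in> E \<longrightarrow> f x \<noteq> f u)) \<and>
     (\<forall>x\<in>V. {u, x} \<in> E \<longrightarrow> f x \<noteq> i)"

lemma insertable_exists:
  assumes f: "feasible f" and v: "v \<in> V" "f v = 0"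
    and order: "\<And>x. x \<in> V \<Longrightarrow> f x \<noteq> 0 \<Longrightarrow> cap x \<le> cap v"
  shows "\<exists>i u. insertable f v i u"
proof (rule ccontr)
  assume none: "\<nexists>i u. insertable f v i u"
  let ?S = "\<lambda>i. {x \<in> V. lab x = lab v \<and> f x = i}"
  let ?N = "f ` {x \<in> V. {v, x} \<in> E}"
  note fin = finite_V
  have disj: "card (\<Union>i\<in>I. ?S i) = (\<Sum>i\<in>I. card (?S i))" if "finite I" for I
    using fin that by (intro card_UN_disjoint) auto
  \<comment> \<open>If every color were full, the group would have \<open>k * cap v\<close> colored
    members and the uncolored \<open>v\<close> besides.\<close>
  have "\<exists>i\<in>{1..k}. card (?S i) < cap v"
  proof (rule ccontr)
    assume "\<not> ?thesis"
    then have "k * cap v \<le> (\<Sum>i\<in>{1..k}. card (?S i))"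
      using sum_bounded_below[of "{1..k}" "cap v" "\<lambda>i. card (?S i)"] by (auto simp: not_less)
    also have "\<dots> = card (\<Union>i\<in>{1..k}. ?S i)" by (simp add: disj)
    also have "\<dots> < card {u \<in> V. lab u = lab v}"
    proof (rule psubset_card_mono)
      have "v \<notin> (\<Union>i\<in>{1..k}. ?S i)" using v by auto
      then show "(\<Union>i\<in>{1..k}. ?S i) \<subset> {u \<in> V. lab u = lab v}" using v by blast
    qed (use fin in simp)
    finally show False using group_size[OF v(1)] by simp
  qed
  then obtain j where j: "j \<in> {1..k}" "card (?S j) < cap v" by blast
  \<comment> \<open>A color that is neither full nor seen by a neighbour of \<open>v\<close> could
    be given to \<open>v\<close> directly, which is the case \<open>u = v\<close>.\<close>
  have full: "cap v \<le> card (?S i)" if "i \<in> {1..k} - ?N" for i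
  proof (rule ccontr)
    assume "\<not> ?thesis"
    then have "insertable f v i v" using that v unfolding insertable_def by auto
    with none show False by blast
  qed
  \<comment> \<open>At most \<Delta> colors occur around \<open>v\<close>; each of the remaining
    ones is full and so holds \<open>cap v\<close> members of the group.\<close>
  have "card ?N \<le> \<Delta>"
    using card_image_le[of "{x \<in> V. {v, x} \<in> E}" f] card_neighbours_le[OF graph, of v]
      degree[OF v(1)] fin by fastforce
  then have "k - \<Delta> \<le> card ({1..k} - ?N)"
    using diff_card_le_card_Diff[of ?N "{1..k}"] fin by simp
  then have "(k - \<Delta>) * cap v \<le> card ({1..k} - ?N) * cap v" by (rule mult_right_mono) simp
  also have "\<dots> \<le> (\<Sum>i\<in>{1..k} - ?N. card (?S i))"
    using sum_bounded_below[of "{1..k} - ?N" "cap v" "\<lambda>i. card (?S i)"] full by simp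
  also have "\<dots> = card (\<Union>i\<in>{1..k} - ?N. ?S i)" by (simp add: disj)
  finally have many: "(k - \<Delta>) * cap v \<le> card (\<Union>i\<in>{1..k} - ?N. ?S i)" .
  let ?C = "{x \<in> V. f x = j}"
  have "?C = (\<Union>l\<in>lab ` V. {x \<in> V. lab x = l \<and> f x = j})" by auto
  then have "card ?C \<le> (\<Sum>l\<in>lab ` V. card {x \<in> V. lab x = l \<and> f x = j})"
    using card_UN_le[of "lab ` V" "\<lambda>l. {x \<in> V. lab x = l \<and> f x = j}"] fin by simp
  also have "\<dots> \<le> card (lab ` V) * cap v"
  proof (rule sum_bounded_above[where K = "cap v", simplified])
    fix l assume "l \<in> lab ` V"
    show "card {x \<in> V. lab x = l \<and> f x = j} \<le> cap v"
    proof (cases "{x \<in> V. lab x = l \<and> f x = j} = {}")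
      case False
      \<comment> \<open>The insertion order enters here: a group that meets color \<open>j\<close>
        has a colored member, so its capacity is at most \<open>cap v\<close>.\<close>
      then obtain x where x: "x \<in> V" "lab x = l" "f x = j" by blast
      then have "card {x \<in> V. lab x = l \<and> f x = j} \<le> cap x"
        using f j(1) unfolding feasible_def by blast
      also have "\<dots> \<le> cap v" using order[OF x(1)] x(3) j(1) by simp
      finally show ?thesis .
    qed (simp only: card.empty zero_le)
  qed
  also have "\<dots> \<le> m * cap v" using labels by (rule mult_right_mono) simp
  finally have C: "card ?C \<le> m * cap v" .
  \<comment> \<open>The vertices with a neighbour of color \<open>j\<close>, which cannot move to
    \<open>j\<close>.\<close>
  let ?B = "\<Union>x\<in>?C. {u \<in> V. {x, u} \<in> E}"
  have "card ?B \<le> (\<Sum>x\<in>?C. card {u \<in> V. {x, u} \<in> E})"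
    using fin by (intro card_UN_le) simp
  also have "\<dots> \<le> card ?C * \<Delta>"
    using card_neighbours_le[OF graph] degree le_trans
    by (intro sum_bounded_above[where K = \<Delta>, simplified]) blast
  also have "\<dots> \<le> m * cap v * \<Delta>" using C by (rule mult_right_mono) simp
  also have "\<dots> = (m * \<Delta>) * cap v" by (simp add: ac_simps)
  \<comment> \<open>Strictness requires \<open>cap v > 0\<close>, which holds because color
    \<open>j\<close> is not full.\<close>
  also have "\<dots> < (k - \<Delta>) * cap v"
    using many_colors j(2) by (intro mult_strict_right_mono) auto
  also note many
  finally have "\<not> (\<Union>i\<in>{1..k} - ?N. ?S i) \<subseteq> ?B"
    using card_mono[of ?B "\<Union>i\<in>{1..k} - ?N. ?S i"] fin by fastforce
  then obtain u where u: "u \<in> V" "lab u = lab v" "f u \<in> {1..k}" "f u \<notin> ?N" "u \<notin> ?B" by blast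
  then have "insertable f v j u"
    using j unfolding insertable_def
    by (simp add: insert_commute[of u] image_iff) metis
  with none show False by blast
qed

text \<open>In the old color of \<open>u\<close> the group trades \<open>u\<close> for
  \<open>v\<close>, so among the true colors only \<open>i\<close> gains a vertex, and it had room.
  For \<open>u = v\<close> the second update overrides the first, and \<open>v\<close> just receives
  \<open>i\<close>.\<close>

lemma feasible_insert:
  assumes f: "feasible f" and v: "v \<in> V" "f v = 0" and ins: "insertable f v i u"
  defines "g \<equiv> f(v := f u, u := i)"
  shows "feasible g" and "\<And>x. x \<in> V \<Longrightarrow> g x \<noteq> 0 \<longleftrightarrow> x = v \<or> f x \<noteq> 0"
proof -
  note fin = finite_V
  have u: "u \<in> V" "lab u = lab v" and i: "i \<in> {1..k}"
    using ins by (auto simp: insertable_def)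
  have le: "card {x \<in> V. lab x = lab v \<and> f x = i} < cap v"
    using ins by (simp add: insertable_def)
  show "g x \<noteq> 0 \<longleftrightarrow> x = v \<or> f x \<noteq> 0" if "x \<in> V" for x
    using ins v by (auto simp: insertable_def g_def)
  have "g x \<le> k" if "x \<in> V" for x
    using that f u i v by (auto simp: g_def feasible_def)
  moreover have "g x \<noteq> g y" if e: "x \<in> V" "y \<in> V" "{x, y} \<in> E" "g x \<noteq> 0" for x y
  proof -
    have xy: "x \<noteq> y" "{y, x} \<in> E" using e no_loop by (auto simp: insert_commute)
    have p: "f a \<noteq> f b" if "a \<in> V" "b \<in> V" "{a, b} \<in> E" "f a \<noteq> 0" for a b
      using f that by (auto simp: feasible_def)
    have ui: "f a \<noteq> i" if "a \<in> V" "{u, a} \<in> E" for a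
      using ins that by (auto simp: insertable_def)
    \<comment> \<open>With \<open>a = u\<close> this also excludes an edge between \<open>u\<close>
      and \<open>v\<close>.\<close>
    have vu: "f a \<noteq> f u" if "u \<noteq> v" "a \<in> V" "{v, a} \<in> E" for a
      using ins that by (auto simp: insertable_def)
    have fu: "u = v \<or> f u \<noteq> 0" using ins by (auto simp: insertable_def)
    show ?thesis
      using e xy p[of x y] p[of y x] ui[of x] ui[of y] vu[of x] vu[of y] i v fu
      by (auto simp: g_def split: if_splits)
  qed
  moreover have "card {x \<in> V. lab x = lab a \<and> g x = j} \<le> cap a"
    if a: "a \<in> V" and j: "j \<in> {1..k}" for a j
  proof -
    have old: "card {x \<in> V. lab x = lab a \<and> f x = j} \<le> cap a"
      using f a j by (auto simp: feasible_def)
    show ?thesis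
    proof (cases "lab a = lab v")
      case False
      then have "{x \<in> V. lab x = lab a \<and> g x = j} = {x \<in> V. lab x = lab a \<and> f x = j}"
        using u by (auto simp: g_def)
      with old show ?thesis by simp
    next
      case True
      then have cap: "cap a = cap v" using a v by (intro cap_lab)
      show ?thesis
      proof (cases "j = i")
        case j: True
        \<comment> \<open>The newcomer in color \<open>i\<close> is \<open>u\<close>, unless
          \<open>u\<close> had this color already and \<open>v\<close> joins it there.\<close>
        let ?z = "if f u = i then v else u"
        have "{x \<in> V. lab x = lab a \<and> g x = j} \<subseteq> insert ?z {x \<in> V. lab x = lab v \<and> f x = i}"
          using j True by (auto simp: g_def split: if_splits)
        then have "card {x \<in> V. lab x = lab a \<and> g x = j} \<le>
            card (insert ?z {x \<in> V. lab x = lab v \<and> f x = i})"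
          using fin by (intro card_mono) auto
        also have "\<dots> \<le> Suc (card {x \<in> V. lab x = lab v \<and> f x = i})"
          by (rule card_insert_le_m1[of "Suc _", simplified]) simp_all
        finally show ?thesis using le cap by simp
      next
        case ji: False
        show ?thesis
        proof (cases "u \<noteq> v \<and> j = f u")
          case True
          let ?A = "{x \<in> V. lab x = lab a \<and> f x = j}"
          have "u \<in> ?A" using u True \<open>lab a = lab v\<close> by simp
          have "{x \<in> V. lab x = lab a \<and> g x = j} \<subseteq> insert v (?A - {u})"
            using ji by (auto simp: g_def split: if_splits)
          then have "card {x \<in> V. lab x = lab a \<and> g x = j} \<le> card (insert v (?A - {u}))"
            using fin by (intro card_mono) auto
          also have "\<dots> \<le> Suc (card (?A - {u}))"
            by (rule card_insert_le_m1[of "Suc _", simplified]) simp_all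
          also have "\<dots> = card ?A"
            using \<open>u \<in> ?A\<close> fin by (intro card_Suc_Diff1) auto
          finally show ?thesis using old by linarith
        next
          case False
          then have "{x \<in> V. lab x = lab a \<and> g x = j} \<subseteq> {x \<in> V. lab x = lab a \<and> f x = j}"
            using ji by (auto simp: g_def split: if_splits)
          then have "card {x \<in> V. lab x = lab a \<and> g x = j} \<le> card {x \<in> V. lab x = lab a \<and> f x = j}"
            using fin by (intro card_mono) auto
          with old show ?thesis by linarith
        qed
      qed
    qed
  qed
  ultimately show "feasible g" unfolding feasible_def by blast
qed

text \<open>If \<open>k\<close> divides the size of a group, the capacities leave no slack.\<close>

lemma feasible_exact:
  assumes f: "feasible f" and colored: "\<And>x. x \<in> V \<Longrightarrow> f x \<noteq> 0"
    and v: "v \<in> V" "card {u \<in> V. lab u = lab v} = k * cap v" and i: "i \<in> {1..k}"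
  shows "card {x \<in> V. lab x = lab v \<and> f x = i} = cap v"
proof (rule antisym)
  let ?S = "\<lambda>i. {x \<in> V. lab x = lab v \<and> f x = i}"
  note fin = finite_V
  have le: "card (?S j) \<le> cap v" if "j \<in> {1..k}" for j
    using f v that by (auto simp: feasible_def)
  then show "card (?S i) \<le> cap v" using i by blast
  have range: "f x \<in> {1..k}" if "x \<in> V" for x
    using f colored[OF that] that by (auto simp: feasible_def)
  then have "{u \<in> V. lab u = lab v} = (\<Union>j\<in>{1..k}. ?S j)" by auto
  then have "k * cap v = (\<Sum>j\<in>{1..k}. card (?S j))"
    using v(2) fin card_UN_disjoint[of "{1..k}" ?S] by auto
  also have "\<dots> = card (?S i) + (\<Sum>j\<in>{1..k} - {i}. card (?S j))"
    using i by (intro sum.remove) auto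
  also have "\<dots> \<le> card (?S i) + card ({1..k} - {i}) * cap v"
    using le by (intro add_left_mono sum_bounded_above[where K = "cap v", simplified]) auto
  also have "card ({1..k} - {i}) = k - 1" using i by simp
  finally have "k * cap v \<le> card (?S i) + (k - 1) * cap v" .
  moreover have "k * cap v = cap v + (k - 1) * cap v" using i by (cases k) auto
  ultimately show "cap v \<le> card (?S i)" by linarith
qed

end

section \<open>A counting criterion for EQ1\<close>

lemma finite_obtains_maximizer:
  fixes w :: "'a \<Rightarrow> 'b :: linorder"
  assumes "finite A" "A \<noteq> {}"
  obtains a where "a \<in> A" "\<And>v. v \<in> A \<Longrightarrow> w v \<le> w a"
proof -
  have "Max (w ` A) \<in> w ` A" using assms by simp
  then obtain a where "a \<in> A" "w a = Max (w ` A)" by force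
  then show thesis using assms by (intro that[of a]) simp_all
qed

text \<open>Induction on the size of \<open>A\<close>: pair a heaviest \<open>a\<close> of
  \<open>A\<close> with some \<open>b\<close> of at least its weight. For thresholds up to
  \<open>w a\<close> both counts drop by one, and above \<open>w a\<close> nothing of
  \<open>A\<close> is counted.\<close>

lemma sum_le_if_dominated:
  fixes w :: "'a \<Rightarrow> 'b :: linordered_idom"
  assumes "finite A" "finite B" "\<And>v. v \<in> B \<Longrightarrow> 0 \<le> w v"
    and "\<And>x. card {v \<in> A. x \<le> w v} \<le> card {v \<in> B. x \<le> w v}"
  shows "sum w A \<le> sum w B"
  using assms
proof (induction "card A" arbitrary: A B)
  case 0
  then show ?case by (simp add: sum_nonneg)
next
  case (Suc c)
  have "A \<noteq> {}" using Suc(2) by auto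
  then obtain a where a: "a \<in> A" "\<And>v. v \<in> A \<Longrightarrow> w v \<le> w a"
    using finite_obtains_maximizer[OF Suc.prems(1), of w] by blast
  have "a \<in> {v \<in> A. w a \<le> w v}" using a by simp
  then have "0 < card {v \<in> A. w a \<le> w v}" using Suc.prems(1) by (auto simp: card_gt_0_iff)
  then have "0 < card {v \<in> B. w a \<le> w v}" using Suc.prems(4)[of "w a"] by linarith
  then obtain b where b: "b \<in> B" "w a \<le> w b" by (auto simp: card_gt_0_iff)
  have "sum w (A - {a}) \<le> sum w (B - {b})"
  proof (rule Suc.hyps(1))
    fix x
    show "card {v \<in> A - {a}. x \<le> w v} \<le> card {v \<in> B - {b}. x \<le> w v}"
    proof (cases "x \<le> w a")
      case True
      have "{v \<in> A - {a}. x \<le> w v} = {v \<in> A. x \<le> w v} - {a}"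
        "{v \<in> B - {b}. x \<le> w v} = {v \<in> B. x \<le> w v} - {b}" by auto
      then show ?thesis using True a(1) b Suc.prems(4)[of x] by (simp add: diff_le_mono)
    next
      case False
      then have "{v \<in> A - {a}. x \<le> w v} = {}" using a(2) by fastforce
      then show ?thesis by (simp only: card.empty zero_le)
    qed
  qed (use Suc a in auto)
  then show ?case using a(1) b Suc.prems(1,2) by (simp add: sum.remove[of A a] sum.remove[of B b])
qed

text \<open>Removing a heaviest vertex lowers the count of \<open>C i\<close> by one for each
  threshold up to its weight, which cancels the slack of 1, and beyond that weight the class is
  empty.\<close>

lemma EQ1_if_counts_close:
  assumes fin: "\<And>i. i \<in> {1..k} \<Longrightarrow> finite (C i)"
    and nonneg: "\<And>i v. i \<in> {1..k} \<Longrightarrow> v \<in> C i \<Longrightarrow> 0 \<le> w v"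
    and close: "\<And>i j x. i \<in> {1..k} \<Longrightarrow> j \<in> {1..k} \<Longrightarrow>
      card {v \<in> C i. x \<le> w v} \<le> card {v \<in> C j. x \<le> w v} + 1"
  shows "EQ1 w k C"
  unfolding EQ1_def
proof (intro ballI impI)
  fix i j assume i: "i \<in> {1..k}" and j: "j \<in> {1..k}" and ne: "C i \<noteq> {}"
  obtain a where a: "a \<in> C i" "\<And>v. v \<in> C i \<Longrightarrow> w v \<le> w a"
    using finite_obtains_maximizer[OF fin[OF i] ne, of w] by blast
  have "sum w (C i - {a}) \<le> sum w (C j)"
  proof (rule sum_le_if_dominated)
    fix x
    show "card {v \<in> C i - {a}. x \<le> w v} \<le> card {v \<in> C j. x \<le> w v}"
    proof (cases "x \<le> w a")
      case True
      have "{v \<in> C i - {a}. x \<le> w v} = {v \<in> C i. x \<le> w v} - {a}" by auto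
      then show ?thesis using True a(1) close[OF i j, of x] fin[OF i] by simp
    next
      case False
      then have "{v \<in> C i - {a}. x \<le> w v} = {}" using a(2) by fastforce
      then show ?thesis by (simp only: card.empty zero_le)
    qed
  qed (use fin nonneg i j in auto)
  then show "\<exists>v\<in>C i. sum w (C i - {v}) \<le> sum w (C j)" using a by blast
qed

section \<open>Grouping vertices by weight and rank\<close>

locale weighted_vertices =
  fixes n :: nat and w :: "nat \<Rightarrow> rat" and k :: nat
  assumes k_pos: "1 \<le> k"
begin

definition above :: "nat \<Rightarrow> nat" where
  "above v = card {x \<in> {..<n}. w v < w x}"

definition atleast :: "nat \<Rightarrow> nat" where
  "atleast v = card {x \<in> {..<n}. w v \<le> w x}"

text \<open>Ties are broken by vertex number, which makes the ranking injective.\<close>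

definition rank :: "nat \<Rightarrow> nat" where
  "rank v = card {x \<in> {..<n}. w v < w x \<or> w x = w v \<and> x < v}"

definition block :: "nat \<Rightarrow> nat" where
  "block v = rank v div k"

text \<open>The vertices of weight \<open>w v\<close> have the ranks in \<open>{above v..<atleast v}\<close>, so \<open>pure v\<close> says that
  the block of \<open>v\<close> is complete and all its vertices have the same weight.\<close>

definition pure :: "nat \<Rightarrow> bool" where
  "pure v \<longleftrightarrow> above v \<le> k * block v \<and> k * (block v + 1) \<le> atleast v"

text \<open>The number \<open>above v\<close> identifies the weight of \<open>v\<close>, so all pure
  blocks of one weight share a group, while an impure block is a group by itself. The Boolean keeps
  the two numberings apart.\<close>

definition group :: "nat \<Rightarrow> bool \<times> nat" where
  "group v = (pure v, if pure v then above v else block v)"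

definition size :: "nat \<Rightarrow> nat" where
  "size v = card {x \<in> {..<n}. group x = group v}"

text \<open>The quotient of \<open>size v\<close> by \<open>k\<close>, rounded up.\<close>

definition capacity :: "nat \<Rightarrow> nat" where
  "capacity v = (size v + k - 1) div k"

text \<open>A weight threshold cuts off an initial segment of the ranking, since everything ranked
  before \<open>v\<close> weighs at least \<open>w v\<close>.\<close>

lemma rank_less_iff:
  assumes v: "v < n"
  shows "rank v < card {u \<in> {..<n}. x \<le> w u} \<longleftrightarrow> x \<le> w v"
proof
  assume "x \<le> w v"
  then have "{u \<in> {..<n}. w v < w u \<or> w u = w v \<and> u < v} \<subseteq> {u \<in> {..<n}. x \<le> w u} - {v}" by auto
  then have "rank v \<le> card ({u \<in> {..<n}. x \<le> w u} - {v})"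
    unfolding rank_def by (intro card_mono) auto
  also have "\<dots> < card {u \<in> {..<n}. x \<le> w u}"
    using v \<open>x \<le> w v\<close> by (intro card_Diff1_less) auto
  finally show "rank v < card {u \<in> {..<n}. x \<le> w u}" .
next
  assume less: "rank v < card {u \<in> {..<n}. x \<le> w u}"
  show "x \<le> w v"
  proof (rule ccontr)
    assume "\<not> x \<le> w v"
    then have "card {u \<in> {..<n}. x \<le> w u} \<le> rank v"
      unfolding rank_def by (intro card_mono) auto
    with less show False by simp
  qed
qed

lemma rank_less_atleast: "v < n \<Longrightarrow> rank v < atleast u \<longleftrightarrow> w u \<le> w v"
  using rank_less_iff[of v "w u"] by (simp add: atleast_def)

lemma rank_less_above:
  assumes "v < n"
  shows "rank v < above u \<longleftrightarrow> w u < w v"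
proof
  assume "w u < w v"
  then have "{x \<in> {..<n}. w v < w x \<or> w x = w v \<and> x < v} \<subseteq> {x \<in> {..<n}. w u < w x} - {v}" by auto
  then have "rank v \<le> card ({x \<in> {..<n}. w u < w x} - {v})"
    unfolding rank_def by (intro card_mono) auto
  also have "\<dots> < above u"
    using assms \<open>w u < w v\<close> unfolding above_def by (intro card_Diff1_less) auto
  finally show "rank v < above u" .
next
  assume less: "rank v < above u"
  show "w u < w v"
  proof (rule ccontr)
    assume "\<not> w u < w v"
    then have "above u \<le> rank v"
      unfolding rank_def above_def by (intro card_mono) auto
    with less show False by simp
  qed
qed

lemma rank_less_size: "v < n \<Longrightarrow> rank v < n"
proof -
  assume v: "v < n"
  have "rank v \<le> card ({..<n} - {v})"
    unfolding rank_def by (intro card_mono) auto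
  then show ?thesis using v by simp
qed

lemma inj_on_rank: "inj_on rank {..<n}"
proof -
  have "rank u < rank v" if "u < n" "v < n" "w v < w u \<or> w u = w v \<and> u < v" for u v
  proof -
    have "{x \<in> {..<n}. w u < w x \<or> w x = w u \<and> x < u} \<subseteq>
        {x \<in> {..<n}. w v < w x \<or> w x = w v \<and> x < v} - {u}"
      using that by auto
    then have "rank u \<le> card ({x \<in> {..<n}. w v < w x \<or> w x = w v \<and> x < v} - {u})"
      unfolding rank_def by (intro card_mono) auto
    also have "\<dots> < rank v"
      using that unfolding rank_def by (intro card_Diff1_less) auto
    finally show ?thesis .
  qed
  then show ?thesis
    unfolding inj_on_def by (metis lessThan_iff less_irrefl linorder_neqE)
qed

lemma bij_betw_rank: "bij_betw rank {..<n} {..<n}"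
proof -
  have "rank ` {..<n} \<subseteq> {..<n}" using rank_less_size by auto
  then have "rank ` {..<n} = {..<n}"
    using inj_on_rank by (intro endo_inj_surj) auto
  then show ?thesis using inj_on_rank by (simp add: bij_betw_def)
qed

lemma block_bounds: "k * block v \<le> rank v" "rank v < k * (block v + 1)"
  using k_pos dividend_less_times_div[of k "rank v"] by (auto simp: block_def)

lemma same_weight:
  assumes "w u = w v"
  shows "above u = above v" "atleast u = atleast v"
  using assms by (simp_all add: above_def atleast_def)

text \<open>The whole block lies in the rank interval of the weight of \<open>u\<close>, so each
  rank in it belongs to that weight.\<close>

lemma pure_block:
  assumes "u < n" "v < n" "block u = block v" "pure u"
  shows "pure v" "w v = w u"
proof -
  have "above u \<le> rank v" "rank v < atleast u"
    using assms block_bounds[of v] by (auto simp: pure_def)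
  then show "w v = w u"
    using rank_less_above[OF assms(2), of u] rank_less_atleast[OF assms(2), of u] by auto
  from same_weight[OF this] show "pure v" using assms by (simp add: pure_def)
qed

lemma group_eq_if_block_eq:
  assumes "u < n" "v < n" "block u = block v"
  shows "group u = group v"
proof (cases "pure u")
  case True
  note v = pure_block[OF assms True]
  from same_weight(1)[OF v(2)] show ?thesis using v(1) True by (simp add: group_def)
next
  case False
  then have "\<not> pure v" using pure_block(1)[OF assms(2,1) assms(3)[symmetric]] by blast
  with False show ?thesis using assms(3) by (simp add: group_def)
qed

lemma group_eq_pure:
  assumes "u < n" "v < n" "group u = group v" "pure v"
  shows "w u = w v" "pure u"
proof -
  show "pure u" using assms by (simp add: group_def)
  have "above u = above v" using assms by (simp add: group_def split: if_splits)
  then show "w u = w v"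
    using rank_less_above[OF assms(1)] rank_less_above[OF assms(2)] by (metis less_irrefl linorder_neqE)
qed

text \<open>Each weight yields at most three groups: its pure blocks taken together, and the impure
  blocks containing the first rank of its interval or the position just after the last.\<close>

lemma card_groups: "card (group ` {..<n}) \<le> 3 * card (w ` {..<n})"
proof -
  let ?V = "{..<n}"
  let ?up = "\<lambda>y. card {x \<in> ?V. y < w x}" and ?atleast = "\<lambda>y. card {x \<in> ?V. y \<le> w x}"
  let ?A = "(\<lambda>y. (True, ?up y)) ` w ` ?V" and ?B = "(\<lambda>y. (False, ?up y div k)) ` w ` ?V"
    and ?C = "(\<lambda>y. (False, ?atleast y div k)) ` w ` ?V"
  have "group v \<in> ?A \<union> ?B \<union> ?C" if v: "v \<in> ?V" for v
  proof (cases "pure v")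
    case True
    then show ?thesis using v by (auto simp: group_def above_def)
  next
    case False
    have "above v \<le> rank v" "rank v < atleast v"
      using rank_less_above[of v v] rank_less_atleast[of v v] v by auto
    then have "block v = above v div k \<or> block v = atleast v div k"
      using False block_bounds[of v] k_pos div_nat_eqI[of k "block v" "above v"]
        div_nat_eqI[of k "block v" "atleast v"]
      by (auto simp: pure_def ac_simps)
    then show ?thesis using v False by (auto simp: group_def above_def atleast_def)
  qed
  then have "group ` ?V \<subseteq> ?A \<union> ?B \<union> ?C" by blast
  then have "card (group ` ?V) \<le> card (?A \<union> ?B \<union> ?C)" by (intro card_mono) auto
  also have "\<dots> \<le> card ?A + card ?B + card ?C"
    using card_Un_le[of "?A \<union> ?B" ?C] card_Un_le[of ?A ?B] by linarith
  also have "\<dots> \<le> card (w ` ?V) + card (w ` ?V) + card (w ` ?V)"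
    by (intro add_mono card_image_le) auto
  finally show ?thesis by simp
qed

lemma size_le_capacity: "size v \<le> k * capacity v"
proof -
  have "size v + k - 1 < k * (capacity v + 1)"
    using k_pos dividend_less_times_div[of k "size v + k - 1"] by (simp add: capacity_def)
  then show ?thesis using k_pos by simp
qed

lemma capacity_exact: "k dvd size v \<Longrightarrow> size v = k * capacity v"
proof -
  assume "k dvd size v"
  then obtain c where c: "size v = k * c" by (rule dvdE)
  then have "size v + k - 1 = k * c + (k - 1)" using k_pos by simp
  then have "capacity v = c" unfolding capacity_def
    using k_pos by (intro div_nat_eqI) auto
  with c show ?thesis by simp
qed

lemma capacity_pos: "v < n \<Longrightarrow> 1 \<le> capacity v"
proof -
  assume "v < n"
  then have "v \<in> {x \<in> {..<n}. group x = group v}" by simp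
  then have "0 < size v" unfolding size_def by (subst card_gt_0_iff) auto
  then show ?thesis using size_le_capacity[of v] by (cases "capacity v") auto
qed

text \<open>Together with \<open>capacity_pos\<close> this confines capacities to the values from 1
  to \<open>n\<close> that the outer loop of \<open>color_all\<close> goes through.\<close>

lemma capacity_le: "capacity v \<le> n"
proof -
  have "size v \<le> n" unfolding size_def
    using card_mono[of "{..<n}" "{x \<in> {..<n}. group x = group v}"] by auto
  then have "size v + k - 1 \<le> k * n + (k - 1)"
    using k_pos mult_le_mono1[of 1 k n] by linarith
  then have "capacity v \<le> (k * n + (k - 1)) div k"
    unfolding capacity_def by (rule div_le_mono)
  also have "\<dots> = n" using k_pos by (intro div_nat_eqI) auto
  finally show ?thesis .
qed

lemma card_full_block:
  assumes "k * (c + 1) \<le> n"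
  shows "card {v \<in> {..<n}. block v = c} = k"
proof -
  have "bij_betw rank {v \<in> {..<n}. block v = c} {k * c..<k * (c + 1)}"
  proof (rule bij_betw_subset[OF bij_betw_rank])
    show "rank ` {v \<in> {..<n}. block v = c} = {k * c..<k * (c + 1)}"
    proof (intro equalityI subsetI)
      fix r assume "r \<in> rank ` {v \<in> {..<n}. block v = c}"
      then obtain v where "r = rank v" "c = block v" by blast
      then show "r \<in> {k * c..<k * (c + 1)}" using block_bounds[of v] by simp
    next
      fix r assume r: "r \<in> {k * c..<k * (c + 1)}"
      then have "r \<in> rank ` {..<n}"
        using bij_betw_rank assms by (auto simp: bij_betw_def)
      moreover have "r div k = c" using r by (intro div_nat_eqI) (auto simp: ac_simps)
      ultimately show "r \<in> rank ` {v \<in> {..<n}. block v = c}" by (auto simp: block_def)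
    qed
  qed auto
  then show ?thesis by (simp add: bij_betw_same_card)
qed

text \<open>The vertices of weight at least \<open>x\<close> are those of rank below some number \<open>N\<close>. The blocks
  before \<open>N div k\<close> form a union of complete groups, and what remains of the next block lies in
  a group of capacity 1.\<close>

lemma group_below_threshold:
  fixes x :: rat
  defines "a \<equiv> card {u \<in> {..<n}. x \<le> w u} div k"
  assumes v: "v < n" and b: "block v < a"
  shows "x \<le> w v"
    and "\<And>u. u < n \<Longrightarrow> group u = group v \<Longrightarrow> block u < a"
    and "size v = k * capacity v"
proof -
  let ?N = "card {u \<in> {..<n}. x \<le> w u}"
  have N: "k * a \<le> ?N" "?N \<le> n"
    using card_mono[of "{..<n}" "{u \<in> {..<n}. x \<le> w u}"] by (auto simp: a_def)
  have "rank v < k * (block v + 1)" by (rule block_bounds)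
  also have "\<dots> \<le> k * a" using b by (intro mult_left_mono) auto
  finally have "rank v < ?N" using N by simp
  then show x: "x \<le> w v" using rank_less_iff[OF v] by simp
  show closed: "block u < a" if u: "u < n" "group u = group v" for u
  proof (cases "pure v")
    case True
    from group_eq_pure[OF u(1) v u(2) True] have "w u = w v" "pure u" by auto
    \<comment> \<open>The block of \<open>u\<close> ends inside the rank interval of the common
      weight, hence within the first \<open>?N\<close> ranks.\<close>
    then have "k * (block u + 1) \<le> atleast v" using same_weight[of u v] by (simp add: pure_def)
    also have "\<dots> \<le> ?N" unfolding atleast_def using x by (intro card_mono) auto
    finally have "block u + 1 \<le> a"
      unfolding a_def using k_pos by (simp add: less_eq_div_iff_mult_less_eq ac_simps)
    then show ?thesis by simp
  next
    case False
    then show ?thesis using u b by (simp add: group_def split: if_splits)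
  qed
  let ?G = "{u \<in> {..<n}. group u = group v}"
  \<comment> \<open>No block is split between groups, so the group is a union of blocks. They all
    end by rank \<open>?N\<close>, at most \<open>n\<close>, and thus have exactly \<open>k\<close>
    vertices each.\<close>
  have "?G = (\<Union>c\<in>block ` ?G. {u \<in> {..<n}. block u = c})"
  proof (intro equalityI subsetI)
    fix u assume "u \<in> (\<Union>c\<in>block ` ?G. {u \<in> {..<n}. block u = c})"
    then obtain z where "z \<in> ?G" "u < n" "block u = block z" by blast
    then show "u \<in> ?G" using group_eq_if_block_eq[of u z] by simp
  qed blast
  then have "size v = card (\<Union>c\<in>block ` ?G. {u \<in> {..<n}. block u = c})"
    unfolding size_def by simp
  also have "\<dots> = (\<Sum>c\<in>block ` ?G. card {u \<in> {..<n}. block u = c})"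
    by (intro card_UN_disjoint) auto
  also have "\<dots> = (\<Sum>c\<in>block ` ?G. k)"
  proof (intro sum.cong refl card_full_block)
    fix c assume "c \<in> block ` ?G"
    then have "c < a" using closed by auto
    then have "k * (c + 1) \<le> k * a" by (intro mult_left_mono) auto
    then show "k * (c + 1) \<le> n" using N by simp
  qed
  finally show "size v = k * capacity v" by (intro capacity_exact) simp
qed

text \<open>Block \<open>a\<close> extends beyond the ranks of weight at least \<open>x\<close>,
  while a pure block of weight \<open>w v\<close> would end within them. So it is impure, a group of
  its own with at most \<open>k\<close> vertices.\<close>

lemma capacity_at_threshold:
  fixes x :: rat
  defines "a \<equiv> card {u \<in> {..<n}. x \<le> w u} div k"
  assumes v: "v < n" "x \<le> w v" and b: "\<not> block v < a"
  shows "block v = a" and "capacity v \<le> 1"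
proof -
  let ?N = "card {u \<in> {..<n}. x \<le> w u}"
  have N: "?N < k * (a + 1)"
    unfolding a_def using k_pos dividend_less_times_div[of k ?N] by simp
  have "k * block v \<le> rank v" by (rule block_bounds)
  also have "rank v < ?N" using rank_less_iff v by simp
  also note N
  finally have "block v < a + 1" by (simp only: mult_less_cancel1)
  then show ba: "block v = a" using b by simp
  have "\<not> pure v"
  proof
    assume "pure v"
    then have "k * (a + 1) \<le> atleast v" using ba by (simp add: pure_def)
    also have "\<dots> \<le> ?N" unfolding atleast_def using v by (intro card_mono) auto
    finally show False using N by simp
  qed
  then have sub: "{u \<in> {..<n}. group u = group v} \<subseteq> {u \<in> {..<n}. block u = block v}"
    by (auto simp: group_def split: if_splits)
  have "inj_on rank {u \<in> {..<n}. block u = block v}"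
    using inj_on_rank by (rule inj_on_subset) auto
  moreover have "rank ` {u \<in> {..<n}. block u = block v} \<subseteq> {k * block v..<k * (block v + 1)}"
  proof (rule image_subsetI)
    fix u assume "u \<in> {u \<in> {..<n}. block u = block v}"
    then have "block u = block v" by simp
    then show "rank u \<in> {k * block v..<k * (block v + 1)}" using block_bounds[of u] by simp
  qed
  ultimately have "card {u \<in> {..<n}. block u = block v} \<le> card {k * block v..<k * (block v + 1)}"
    by (rule card_inj_on_le) simp
  then have "size v \<le> k"
    using card_mono[OF _ sub] unfolding size_def by simp
  then have "size v + k - 1 < k * 2" using k_pos by simp
  then show "capacity v \<le> 1" unfolding capacity_def using k_pos
    by (metis Suc_1 less_Suc_eq_le less_mult_imp_div_less mult.commute)
qed

end

section \<open>From feasible assignments to EQ1 colorings\<close>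

locale coloring_instance = weighted_vertices n w k
  for n :: nat and w :: "nat \<Rightarrow> rat" and k :: nat +
  fixes E :: "nat set set"
  assumes graph: "simple_graph {..<n} E"
    and nonneg: "\<And>v. v < n \<Longrightarrow> 0 \<le> w v"
    and colors: "(8 * card (w ` {..<n}) + 10) * max_degree {..<n} E \<le> k"
begin

sublocale grouped_graph "{..<n}" E k "3 * card (w ` {..<n})" "max_degree {..<n} E" group capacity
proof
  show "simple_graph {..<n} E" by (rule graph)
  show "vertex_degree E v \<le> max_degree {..<n} E" if "v \<in> {..<n}" for v
    using that by (auto simp: max_degree_def intro!: Max_ge)
  show "capacity u = capacity v" if "group u = group v" for u v
    using that by (simp add: capacity_def size_def)
  show "card {u \<in> {..<n}. group u = group v} \<le> k * capacity v" for v
    using size_le_capacity by (simp add: size_def)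
  show "card (group ` {..<n}) \<le> 3 * card (w ` {..<n})" by (rule card_groups)
  \<comment> \<open>For a positive maximum degree the factor from \<open>colors\<close> is strictly
    larger; for degree 0 the claim is \<open>0 < k\<close>.\<close>
  show "(3 * card (w ` {..<n}) + 1) * max_degree {..<n} E < k"
  proof (cases "max_degree {..<n} E = 0")
    case False
    then have "(3 * card (w ` {..<n}) + 1) * max_degree {..<n} E <
        (8 * card (w ` {..<n}) + 10) * max_degree {..<n} E"
      by (intro mult_strict_right_mono) auto
    with colors show ?thesis by linarith
  qed (use k_pos in simp)
qed

lemma is_coloring_color_classes:
  assumes f: "feasible f" and colored: "\<And>x. x < n \<Longrightarrow> f x \<noteq> 0"
  shows "is_coloring {..<n} E k (color_classes n f)"
proof -
  have range: "f v \<in> {1..k}" if "v < n" for v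
    using f colored[OF that] that by (auto simp: feasible_def)
  have "independent_set {..<n} E (color_classes n f i)" for i
  proof -
    have "{u, v} \<notin> E" if "u < n" "v < n" "f u = i" "f v = i" for u v
      using f that colored[OF that(1)] unfolding feasible_def by (metis lessThan_iff)
    then show ?thesis by (auto simp: independent_set_def color_classes_def)
  qed
  moreover have "disjoint_family_on (color_classes n f) {1..k}"
    by (auto simp: disjoint_family_on_def color_classes_def)
  moreover have "(\<Union>i\<in>{1..k}. color_classes n f i) = {..<n}"
    using range by (auto simp: color_classes_def)
  ultimately show ?thesis by (simp add: is_coloring_def)
qed

text \<open>For a threshold \<open>x\<close>, the blocks before \<open>a\<close> consist of groups
  whose share in every color is exactly their capacity, so they contribute equally to all classes.
  The rest lies in one group of capacity 1 and contributes at most 1.\<close>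

lemma EQ1_color_classes:
  assumes f: "feasible f" and colored: "\<And>x. x < n \<Longrightarrow> f x \<noteq> 0"
  shows "EQ1 w k (color_classes n f)"
proof (rule EQ1_if_counts_close)
  show "finite (color_classes n f i)" for i by (simp add: color_classes_def)
  show "0 \<le> w v" if "v \<in> color_classes n f i" for v i
    using that nonneg by (simp add: color_classes_def)
  fix i j and x :: rat assume i: "i \<in> {1..k}" and j: "j \<in> {1..k}"
  define a where "a = card {u \<in> {..<n}. x \<le> w u} div k"
  let ?F = "{v \<in> {..<n}. block v < a}"
  let ?G = "\<lambda>i l. {v \<in> {..<n}. group v = l \<and> f v = i}"
  let ?low = "\<lambda>i. {v \<in> {..<n}. block v < a \<and> f v = i}"
  let ?rest = "\<lambda>i. {v \<in> {..<n}. x \<le> w v \<and> \<not> block v < a \<and> f v = i}"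
  have split: "{v \<in> color_classes n f i. x \<le> w v} = ?low i \<union> ?rest i" for i
    using group_below_threshold(1)[where x = x, folded a_def] by (auto simp: color_classes_def)
  have low: "card (?low i) = (\<Sum>l\<in>group ` ?F. card (?G i l))" for i
  proof -
    have "?low i = (\<Union>l\<in>group ` ?F. ?G i l)"
      using group_below_threshold(2)[where x = x, folded a_def] by auto
    then have "card (?low i) = card (\<Union>l\<in>group ` ?F. ?G i l)" by (rule arg_cong)
    also have "\<dots> = (\<Sum>l\<in>group ` ?F. card (?G i l))"
      by (intro card_UN_disjoint) auto
    finally show ?thesis .
  qed
  have "card (?G i l) = card (?G j l)" if l: "l \<in> group ` ?F" for l
  proof -
    obtain v where v: "v < n" "block v < a" "l = group v" using l by auto
    have "size v = k * capacity v"
      using group_below_threshold(3)[where x = x, folded a_def] v by blast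
    then have "card (?G i l) = capacity v" if "i \<in> {1..k}" for i
      using feasible_exact[OF f _ _ _ that, of v] colored v by (simp add: size_def)
    then show ?thesis using i j by simp
  qed
  then have eq: "card (?low i) = card (?low j)" unfolding low by (intro sum.cong refl)
  have rest: "card (?rest i) \<le> 1"
  proof (cases "?rest i = {}")
    case False
    then obtain v where v: "v < n" "x \<le> w v" "\<not> block v < a" "f v = i" by blast
    note thr = capacity_at_threshold[where x = x, folded a_def]
    have "?rest i \<subseteq> ?G i (group v)"
    proof
      fix u assume u: "u \<in> ?rest i"
      then have "block u = block v" using thr(1)[of u] thr(1)[of v] v by simp
      then show "u \<in> ?G i (group v)" using group_eq_if_block_eq[of u v] u v by simp
    qed
    then have "card (?rest i) \<le> card (?G i (group v))" by (intro card_mono) auto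
    also have "\<dots> \<le> capacity v" using f v i by (auto simp: feasible_def)
    also have "\<dots> \<le> 1" using thr(2)[OF v(1-3)] .
    finally show ?thesis .
  qed (simp only: card.empty zero_le)
  have "card {v \<in> color_classes n f i. x \<le> w v} \<le> card (?low i) + card (?rest i)"
    unfolding split by (rule card_Un_le)
  also have "\<dots> \<le> card (?low j) + 1" using eq rest by simp
  also have "card (?low j) \<le> card {v \<in> color_classes n f j. x \<le> w v}"
    unfolding split by (intro card_mono) auto
  finally show "card {v \<in> color_classes n f i. x \<le> w v} \<le>
      card {v \<in> color_classes n f j. x \<le> w v} + 1" by simp
qed

end

section \<open>The program\<close>

definition cell :: "nat \<Rightarrow> aexp" where
  "cell x = Arr x (Const 0)"

definition eqb :: "aexp \<Rightarrow> aexp \<Rightarrow> bexp" where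
  "eqb a b = BAnd (BNot (Less a b)) (BNot (Less b a))"

definition orb :: "bexp \<Rightarrow> bexp \<Rightarrow> bexp" where
  "orb a b = BNot (BAnd (BNot a) (BNot b))"

lemma aval_cell [simp]: "aval (cell x) s = s x 0"
  by (simp add: cell_def)

lemma bval_eqb [simp]: "bval (eqb a b) s \<longleftrightarrow> aval a s = aval b s"
  by (auto simp: eqb_def)

lemma bval_orb [simp]: "bval (orb a b) s \<longleftrightarrow> bval a s \<or> bval b s"
  by (simp add: orb_def)

lemma slow_cell [simp]: "slow (cell x)" "slow (Plus (cell x) (Const c)) \<longleftrightarrow> c \<le> 1"
  by (simp_all add: cell_def)

text \<open>The condition \<open>b\<close> refers to the counted number through cell 0 of array 17.\<close>

definition count :: "nat \<Rightarrow> aexp \<Rightarrow> bexp \<Rightarrow> prog" where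
  "count D i b = Then (Do D i (Const 0))
     (For 17 (If b (Do D i (Plus (Arr D i) (Const 1))) Nop))"

lemma well_formed_count [simp]: "well_formed (count D i b) \<longleftrightarrow> D \<noteq> 1 \<and> D \<noteq> 17"
  by (auto simp: count_def)

lemma writes_count [simp]: "writes (count D i b) = {D, 17}"
  by (auto simp: count_def)

text \<open>The premises \<open>i\<close> and \<open>b\<close> ensure that neither the running count
  nor the loop variable shifts the target index, and that the condition depends on \<open>j\<close>
  alone.\<close>

lemma den_count:
  assumes D: "D \<noteq> 17" "D \<noteq> 1" and i0: "aval i s = c"
    and i: "\<And>m j. aval i (upd (upd s D c m) 17 0 j) = c"
    and b: "\<And>m j. j < s 1 0 \<Longrightarrow> bval b (upd (upd s D c m) 17 0 j) \<longleftrightarrow> Q j"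
  shows "den (count D i b) s =
    upd (upd s D c (card {j \<in> {..<s 1 0}. Q j})) 17 0 (s 1 0)"
proof -
  let ?p = "If b (Do D i (Plus (Arr D i) (Const 1))) Nop"
  let ?f = "\<lambda>s. upd (den ?p s) 17 0 (den ?p s 17 0 + 1)"
  let ?u = "\<lambda>m j. upd (upd s D c m) 17 0 j"
  have "(?f ^^ m) (?u 0 0) = ?u (card {j \<in> {..<m}. Q j}) m" if "m \<le> s 1 0" for m
    using that
  proof (induction m)
    case 0
    show ?case by simp
  next
    case (Suc m)
    let ?c = "card {j \<in> {..<m}. Q j}"
    have "{j \<in> {..<Suc m}. Q j} = (if Q m then insert m {j \<in> {..<m}. Q j} else {j \<in> {..<m}. Q j})"
      by (auto simp: less_Suc_eq)
    then have card: "card {j \<in> {..<Suc m}. Q j} = (if Q m then ?c + 1 else ?c)" by simp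
    have den: "den ?p (?u ?c m) = ?u (if Q m then ?c + 1 else ?c) m"
    proof (cases "Q m")
      case True
      then have "den ?p (?u ?c m) = upd (?u ?c m) D c (?u ?c m D c + 1)"
        using b[of m ?c] i[of ?c m] Suc.prems by simp
      also have "\<dots> = ?u (?c + 1) m"
        using D by (intro ext) (auto simp: upd_def)
      finally show ?thesis using True by simp
    next
      case False
      then show ?thesis using b[of m ?c] Suc.prems by simp
    qed
    have "(?f ^^ Suc m) (?u 0 0) = ?f (?u ?c m)" using Suc by simp
    also have "\<dots> = upd (?u (if Q m then ?c + 1 else ?c) m) 17 0 (m + 1)"
      unfolding den by (simp add: upd_same)
    also have "\<dots> = ?u (card {j \<in> {..<Suc m}. Q j}) (Suc m)"
      unfolding card by (intro ext) (auto simp: upd_def)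
    finally show ?case .
  qed
  moreover have "upd s D c 0 1 0 = s 1 0" using D by (simp add: upd_other)
  ultimately show ?thesis using i0 by (simp add: count_def)
qed

text \<open>Arrays: 0 the colors; 1 to 4 the input; 5 to 12 the values \<open>above\<close>, \<open>atleast\<close>, \<open>rank\<close>,
  \<open>block\<close>, \<open>pure\<close>, second component of \<open>group\<close>, \<open>size\<close>, \<open>capacity\<close>; 13 to 17 the loop
  variables \<open>v\<close>, \<open>u\<close>, \<open>i\<close>, \<open>q\<close>, \<open>x\<close>; 18 to 20 counters; 21 a flag. Color \<open>i + 1\<close> is
  represented by the loop index \<open>i\<close>.\<close>

definition lighter :: "nat \<Rightarrow> nat \<Rightarrow> bexp" where
  "lighter a b = Less (Times (Arr 3 (cell a)) (Arr 4 (cell b))) (Times (Arr 3 (cell b)) (Arr 4 (cell a)))"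

definition adjacent :: "nat \<Rightarrow> bexp" where
  "adjacent a = Less (Const 0) (Arr 2 (Plus (Times (cell a) (cell 1)) (cell 17)))"

definition same_group :: "nat \<Rightarrow> nat \<Rightarrow> bexp" where
  "same_group a b = BAnd (eqb (Arr 9 (cell a)) (Arr 9 (cell b))) (eqb (Arr 10 (cell a)) (Arr 10 (cell b)))"

text \<open>The machine cannot divide, so \<open>block\<close> is found by counting the blocks that
  end no later than the rank; \<open>capacity_step\<close> rounds up by counting in the same
  manner.\<close>

definition group_step :: prog where
  "group_step =
      Then (count 5 (cell 13) (lighter 13 17))
     (Then (count 6 (cell 13) (BNot (lighter 17 13)))
     (Then (count 7 (cell 13) (orb (lighter 13 17)
        (BAnd (BNot (lighter 17 13)) (Less (cell 17) (cell 13)))))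
     (Then (count 8 (cell 13) (BNot (Less (Arr 7 (cell 13))
        (Times (Arr 1 (Const 1)) (Plus (cell 17) (Const 1))))))
     (If (BAnd (BNot (Less (Times (Arr 1 (Const 1)) (Arr 8 (cell 13))) (Arr 5 (cell 13))))
           (BNot (Less (Arr 6 (cell 13)) (Times (Arr 1 (Const 1)) (Plus (Arr 8 (cell 13)) (Const 1))))))
       (Then (Do 9 (cell 13) (Const 1)) (Do 10 (cell 13) (Arr 5 (cell 13))))
       (Then (Do 9 (cell 13) (Const 0)) (Do 10 (cell 13) (Arr 8 (cell 13))))))))"

definition compute_groups :: prog where
  "compute_groups = For 13 group_step"

definition capacity_step :: prog where
  "capacity_step = Then (count 11 (cell 13) (same_group 17 13))
     (count 12 (cell 13) (Less (Times (Arr 1 (Const 1)) (cell 17)) (Arr 11 (cell 13))))"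

definition compute_capacities :: prog where
  "compute_capacities = For 13 capacity_step"

text \<open>Three counters evaluate the set conditions of \<open>insertable\<close>. The flag in
  array 21 stops all exchanges after the first success.\<close>

definition exchange :: prog where
  "exchange =
     Then (count 18 (Const 0) (BAnd (adjacent 13) (eqb (Arr 0 (cell 17)) (Arr 0 (cell 14)))))
    (Then (count 19 (Const 0) (BAnd (adjacent 14) (eqb (Arr 0 (cell 17)) (Plus (cell 15) (Const 1)))))
    (Then (count 20 (Const 0) (BAnd (same_group 17 13) (eqb (Arr 0 (cell 17)) (Plus (cell 15) (Const 1)))))
    (If (BAnd (eqb (cell 21) (Const 0))
        (BAnd (Less (cell 15) (Arr 1 (Const 1)))
        (BAnd (Less (cell 20) (Arr 12 (cell 13)))
        (BAnd (orb (eqb (cell 14) (cell 13))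
           (BAnd (Less (Const 0) (Arr 0 (cell 14)))
           (BAnd (same_group 14 13) (eqb (cell 18) (Const 0)))))
         (eqb (cell 19) (Const 0))))))
      (Then (Do 0 (cell 13) (Arr 0 (cell 14)))
      (Then (Do 0 (cell 14) (Plus (cell 15) (Const 1)))
        (Do 21 (Const 0) (Const 1))))
      Nop)))"

definition insertion :: prog where
  "insertion = Then (Do 21 (Const 0) (Const 0)) (For 15 (For 14 exchange))"

text \<open>One pass over all vertices for each capacity \<open>q + 1\<close> takes the place of
  sorting.\<close>

definition color_all :: prog where
  "color_all = For 16 (For 13
     (If (eqb (Arr 12 (cell 13)) (Plus (cell 16) (Const 1))) insertion Nop))"

text \<open>All loops run \<open>n\<close> times, so the search sees every color if
  \<open>k < n\<close>. This also keeps the time independent of the magnitude of \<open>k\<close>,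
  which is given in binary.\<close>

definition color_prog :: prog where
  "color_prog = If (Less (Arr 1 (Const 1)) (Arr 1 (Const 0)))
     (Then compute_groups (Then compute_capacities color_all))
     (For 13 (Do 0 (cell 13) (Plus (cell 13) (Const 1))))"

lemma writes_exchange: "writes exchange = {0, 17, 18, 19, 20, 21}"
  by (auto simp: exchange_def)

lemma writes_insertion: "writes insertion = {0, 14, 15, 17, 18, 19, 20, 21}"
  by (auto simp: insertion_def writes_exchange)

lemma well_formed_exchange: "well_formed exchange"
  by (simp add: exchange_def)

lemma well_formed_color_prog: "well_formed color_prog"
  by (simp add: color_prog_def compute_groups_def group_step_def compute_capacities_def
      capacity_step_def color_all_def
      insertion_def well_formed_exchange writes_exchange)

text \<open>The range \<open>{..<n}\<close> cuts nothing off, because the quotient is at most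
  \<open>r\<close>, which is below \<open>n\<close>.\<close>

lemma card_less_div:
  assumes "1 \<le> k" "r < n"
  shows "card {c \<in> {..<n}. \<not> r < k * (c + 1)} = r div k"
proof -
  have "{c \<in> {..<n}. \<not> r < k * (c + 1)} = {..<r div k}"
  proof (intro equalityI subsetI)
    fix c assume "c \<in> {..<r div k}"
    then have "c + 1 \<le> r div k" by simp
    then have "k * (c + 1) \<le> r" using assms by (simp add: less_eq_div_iff_mult_less_eq ac_simps)
    moreover have "c < n" using \<open>c + 1 \<le> r div k\<close> assms(2) div_le_dividend[of r k] by linarith
    ultimately show "c \<in> {c \<in> {..<n}. \<not> r < k * (c + 1)}" by simp
  next
    fix c assume "c \<in> {c \<in> {..<n}. \<not> r < k * (c + 1)}"
    then have "c + 1 \<le> r div k" using assms by (simp add: less_eq_div_iff_mult_less_eq ac_simps)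
    then show "c \<in> {..<r div k}" by simp
  qed
  then show ?thesis by simp
qed

lemma card_less_ceiling:
  assumes "1 \<le> k" "r \<le> n"
  shows "card {c \<in> {..<n}. k * c < r} = (r + k - 1) div k"
proof -
  have less: "k * c < r \<longleftrightarrow> c < (r + k - 1) div k" for c
  proof -
    have "c < (r + k - 1) div k \<longleftrightarrow> Suc c \<le> (r + k - 1) div k" by (rule less_eq_Suc_le)
    also have "\<dots> \<longleftrightarrow> Suc c * k \<le> r + k - 1"
      using assms(1) by (simp only: less_eq_div_iff_mult_less_eq)
    also have "\<dots> \<longleftrightarrow> k * c < r" using assms(1) by (auto simp: mult.commute)
    finally show ?thesis by simp
  qed
  have "c < n" if "k * c < r" for c
    using that assms mult_le_mono1[of 1 k c] by linarith
  then have "{c \<in> {..<n}. k * c < r} = {..<(r + k - 1) div k}" using less by auto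
  then show ?thesis by simp
qed

section \<open>Correctness of the program\<close>

context coloring_instance
begin

text \<open>Weights enter the computation only through comparisons, done by cross multiplication of
  the stored fractions.\<close>

definition holds_input :: "state \<Rightarrow> bool" where
  "holds_input s \<longleftrightarrow> s 0 = (\<lambda>_. 0) \<and> s 1 0 = n \<and> s 1 1 = k \<and>
     (\<forall>u<n. \<forall>v<n. 0 < s 2 (u * n + v) \<longleftrightarrow> {u, v} \<in> E) \<and>
     (\<forall>u<n. \<forall>v<n. s 3 v * s 4 u < s 3 u * s 4 v \<longleftrightarrow> w v < w u)"

text \<open>The bound \<open>m\<close> counts the vertices already treated, for use as a loop
  invariant.\<close>

definition holds_groups :: "state \<Rightarrow> nat \<Rightarrow> bool" where
  "holds_groups s m \<longleftrightarrow> (\<forall>v<m. s 9 v = of_bool (pure v) \<and> s 10 v = snd (group v))"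

definition holds_capacities :: "state \<Rightarrow> nat \<Rightarrow> bool" where
  "holds_capacities s m \<longleftrightarrow> (\<forall>v<m. s 12 v = capacity v)"

lemma holds_input_cong:
  "holds_input s \<Longrightarrow> (\<And>a. a \<in> {0, 1, 2, 3, 4} \<Longrightarrow> r a = s a) \<Longrightarrow> holds_input r"
  by (simp add: holds_input_def)

lemma den_group_step:
  assumes s: "holds_input s" and v: "s 13 0 = v" "v < n"
  shows "den group_step s 9 = (s 9)(v := of_bool (pure v)) \<and> den group_step s 10 = (s 10)(v := snd (group v))"
proof -
  have n: "s 1 0 = n" "s 1 (Suc 0) = k" "s (Suc 0) 0 = n" "s (Suc 0) (Suc 0) = k"
    using s by (auto simp: holds_input_def)
  have less: "s 3 a * s 4 b < s 3 b * s 4 a \<longleftrightarrow> w a < w b" if "a < n" "b < n" for a b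
    using s that by (simp add: holds_input_def)
  note [simp] = n v upd_same upd_other less lighter_def
  define r1 where "r1 = upd (upd s 5 v (above v)) 17 0 n"
  define r2 where "r2 = upd (upd r1 6 v (atleast v)) 17 0 n"
  define r3 where "r3 = upd (upd r2 7 v (rank v)) 17 0 n"
  define r4 where "r4 = upd (upd r3 8 v (block v)) 17 0 n"
  have 1: "den (count 5 (cell 13) (lighter 13 17)) s = r1"
    by (subst den_count[where c = v and Q = "\<lambda>j. w v < w j"]) (simp_all add: r1_def above_def)
  have 2: "den (count 6 (cell 13) (BNot (lighter 17 13))) r1 = r2"
    by (subst den_count[where c = v and Q = "\<lambda>j. w v \<le> w j"])
      (simp_all add: r1_def r2_def atleast_def not_less)
  have 3: "den (count 7 (cell 13) (orb (lighter 13 17)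
        (BAnd (BNot (lighter 17 13)) (Less (cell 17) (cell 13))))) r2 = r3"
    by (subst den_count[where c = v and Q = "\<lambda>j. w v < w j \<or> w j = w v \<and> j < v"])
      (auto simp add: r1_def r2_def r3_def rank_def)
  have 4: "den (count 8 (cell 13) (BNot (Less (Arr 7 (cell 13))
        (Times (Arr 1 (Const 1)) (Plus (cell 17) (Const 1)))))) r3 = r4"
    using card_less_div[OF k_pos rank_less_size[OF v(2)]]
    by (subst den_count[where c = v and Q = "\<lambda>j. \<not> rank v < k * (j + 1)"])
      (simp_all add: r1_def r2_def r3_def r4_def block_def)
  have r4: "r4 1 (Suc 0) = k" "r4 13 0 = v" "r4 5 v = above v" "r4 6 v = atleast v" "r4 8 v = block v"
    "r4 9 = s 9" "r4 10 = s 10"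
    by (simp_all add: r1_def r2_def r3_def r4_def)
  show ?thesis
    unfolding group_step_def den.simps 1 2 3 4
    by (auto simp: r4 r4(1)[simplified] pure_def group_def not_less fun_eq_iff)
qed

lemma den_compute_groups:
  assumes s: "holds_input s"
  shows "holds_input (den compute_groups s) \<and> holds_groups (den compute_groups s) n"
proof -
  have wf: "well_formed (For 13 group_step)" "writes group_step = {5, 6, 7, 8, 9, 10, 17}"
    by (auto simp: group_step_def)
  have "holds_input (den (For 13 group_step) s) \<and> holds_groups (den (For 13 group_step) s) (s 1 0)"
  proof (rule den_For_invariant[OF wf(1), where I = "\<lambda>i s. holds_input s \<and> holds_groups s i"])
    show "holds_input (upd s 13 0 j) \<and> holds_groups (upd s 13 0 j) 0" for j
      by (auto simp: upd_other holds_groups_def intro!: holds_input_cong[OF s])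
  next
    fix i r j assume i: "i < s 1 0" and I: "holds_input r \<and> holds_groups r i" and r: "r 13 0 = i"
    have "i < n" using i s by (simp add: holds_input_def)
    note step = den_group_step[OF conjunct1[OF I] r this]
    have "holds_input (upd (den group_step r) 13 0 j)"
      by (rule holds_input_cong[OF conjunct1[OF I]]) (auto simp: upd_other den_frame wf(2))
    moreover have "holds_groups (upd (den group_step r) 13 0 j) (Suc i)"
      using I step by (auto simp: holds_groups_def upd_other less_Suc_eq)
    ultimately show "holds_input (upd (den group_step r) 13 0 j) \<and> holds_groups (upd (den group_step r) 13 0 j) (Suc i)" ..
  qed
  then show ?thesis using s by (simp add: compute_groups_def holds_input_def)
qed

lemma group_eq_iff:
  assumes "holds_groups s n" "u < n" "v < n"
  shows "s 9 u = s 9 v \<and> s 10 u = s 10 v \<longleftrightarrow> group u = group v"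
  using assms by (auto simp: holds_groups_def group_def)

lemma den_capacity_step:
  assumes s: "holds_input s" "holds_groups s n" and v: "s 13 0 = v" "v < n"
  shows "den capacity_step s 12 = (s 12)(v := capacity v)"
proof -
  have n: "s 1 0 = n" "s 1 (Suc 0) = k" "s (Suc 0) 0 = n" "s (Suc 0) (Suc 0) = k"
    using s by (auto simp: holds_input_def)
  note [simp] = n v upd_same upd_other
  define r1 where "r1 = upd (upd s 11 v (size v)) 17 0 n"
  have 1: "den (count 11 (cell 13) (same_group 17 13)) s = r1"
    using group_eq_iff[OF s(2)]
    by (subst den_count[where c = v and Q = "\<lambda>j. group j = group v"])
      (simp_all add: r1_def size_def same_group_def)
  have "size v \<le> n" unfolding size_def
    using card_mono[of "{..<n}" "{x \<in> {..<n}. group x = group v}"] by auto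
  then have 2: "den (count 12 (cell 13) (Less (Times (Arr 1 (Const 1)) (cell 17)) (Arr 11 (cell 13)))) r1
    = upd (upd r1 12 v (capacity v)) 17 0 n"
    using card_less_ceiling[OF k_pos, of "size v" n]
    by (subst den_count[where c = v and Q = "\<lambda>j. k * j < size v"])
      (simp_all add: r1_def capacity_def)
  show ?thesis unfolding capacity_step_def den.simps 1 2 by (simp add: r1_def fun_eq_iff)
qed

lemma den_compute_capacities:
  assumes s: "holds_input s" "holds_groups s n"
  defines "r \<equiv> den compute_capacities s"
  shows "holds_input r \<and> holds_groups r n \<and> holds_capacities r n"
proof -
  have wf: "well_formed (For 13 capacity_step)" "writes capacity_step = {11, 12, 17}"
    by (auto simp: capacity_step_def)
  let ?I = "\<lambda>i s. holds_input s \<and> holds_groups s n \<and> holds_capacities s i"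
  have "?I (s 1 0) (den (For 13 capacity_step) s)"
  proof (rule den_For_invariant[OF wf(1), where I = ?I])
    show "?I 0 (upd s 13 0 j)" for j
      using s(2)
      by (auto simp: upd_other holds_groups_def holds_capacities_def intro!: holds_input_cong[OF s(1)])
  next
    fix i r j assume i: "i < s 1 0" and I: "?I i r" and r: "r 13 0 = i"
    have "i < n" using i s by (simp add: holds_input_def)
    note step = den_capacity_step[OF conjunct1[OF I] conjunct1[OF conjunct2[OF I]] r this]
    have "holds_input (upd (den capacity_step r) 13 0 j)"
      by (rule holds_input_cong[OF conjunct1[OF I]]) (auto simp: upd_other den_frame wf(2))
    moreover have "holds_groups (upd (den capacity_step r) 13 0 j) n"
      using I by (auto simp: holds_groups_def upd_other den_frame wf(2))
    moreover have "holds_capacities (upd (den capacity_step r) 13 0 j) (Suc i)"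
      using I step by (auto simp: holds_capacities_def upd_other less_Suc_eq)
    ultimately show "?I (Suc i) (upd (den capacity_step r) 13 0 j)" by blast
  qed
  then show ?thesis using s by (simp add: compute_capacities_def r_def holds_input_def)
qed

text \<open>In contrast to \<open>holds_input\<close>, array 0 is left free, so the property
  survives the assignment of colors.\<close>

definition prepared :: "state \<Rightarrow> bool" where
  "prepared s \<longleftrightarrow> s 1 0 = n \<and> s 1 1 = k \<and>
     (\<forall>u<n. \<forall>v<n. 0 < s 2 (u * n + v) \<longleftrightarrow> {u, v} \<in> E) \<and>
     holds_groups s n \<and> holds_capacities s n"

lemma prepared_cong:
  "prepared s \<Longrightarrow> (\<And>a. a \<in> {1, 2, 9, 10, 12} \<Longrightarrow> r a = s a) \<Longrightarrow> prepared r"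
  by (simp add: prepared_def holds_groups_def holds_capacities_def)

lemma den_exchange:
  assumes s: "prepared s" and v: "s 13 0 = v" "v < n" and u: "s 14 0 = u" "u < n"
    and i: "s 15 0 = i"
  defines "P \<equiv> s 21 0 = 0 \<and> insertable (s 0) v (i + 1) u"
  shows "den exchange s 0 = (if P then (s 0)(v := s 0 u, u := i + 1) else s 0)"
    and "den exchange s 21 0 = (if P then 1 else s 21 0)"
proof -
  let ?f = "s 0"
  have n: "s 1 0 = n" "s 1 (Suc 0) = k" "s (Suc 0) 0 = n" "s (Suc 0) (Suc 0) = k"
    using s by (auto simp: prepared_def)
  have adj: "0 < s 2 (a * n + b) \<longleftrightarrow> {a, b} \<in> E" if "a < n" "b < n" for a b
    using s that by (simp add: prepared_def)
  have grp: "s 9 a = s 9 b \<and> s 10 a = s 10 b \<longleftrightarrow> group a = group b" if "a < n" "b < n" for a b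
    using group_eq_iff s that by (simp add: prepared_def)
  have cap: "s 12 v = capacity v" using s v by (simp add: prepared_def holds_capacities_def)
  let ?c1 = "card {j \<in> {..<n}. {v, j} \<in> E \<and> ?f j = ?f u}"
  let ?c2 = "card {j \<in> {..<n}. {u, j} \<in> E \<and> ?f j = i + 1}"
  let ?c3 = "card {j \<in> {..<n}. group j = group v \<and> ?f j = i + 1}"
  have P: "P \<longleftrightarrow> s 21 0 = 0 \<and> i < k \<and> ?c3 < capacity v \<and>
      (u = v \<or> 0 < ?f u \<and> group u = group v \<and> ?c1 = 0) \<and> ?c2 = 0"
    using u v by (auto simp: P_def insertable_def)
  note [simp] = n v u i adj cap upd_same upd_other adjacent_def same_group_def
  define r1 where "r1 = upd (upd s 18 0 ?c1) 17 0 n"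
  define r2 where "r2 = upd (upd r1 19 0 ?c2) 17 0 n"
  define r3 where "r3 = upd (upd r2 20 0 ?c3) 17 0 n"
  have 1: "den (count 18 (Const 0) (BAnd (adjacent 13) (eqb (Arr 0 (cell 17)) (Arr 0 (cell 14))))) s = r1"
    by (subst den_count[where c = 0 and Q = "\<lambda>j. {v, j} \<in> E \<and> ?f j = ?f u"])
      (simp_all add: r1_def)
  have 2: "den (count 19 (Const 0) (BAnd (adjacent 14) (eqb (Arr 0 (cell 17)) (Plus (cell 15) (Const 1))))) r1 = r2"
    by (subst den_count[where c = 0 and Q = "\<lambda>j. {u, j} \<in> E \<and> ?f j = i + 1"])
      (simp_all add: r1_def r2_def)
  have 3: "den (count 20 (Const 0) (BAnd (same_group 17 13) (eqb (Arr 0 (cell 17)) (Plus (cell 15) (Const 1))))) r2 = r3"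
    using grp
    by (subst den_count[where c = 0 and Q = "\<lambda>j. group j = group v \<and> ?f j = i + 1"])
      (simp_all add: r1_def r2_def r3_def)
  let ?b = "BAnd (eqb (cell 21) (Const 0))
        (BAnd (Less (cell 15) (Arr 1 (Const 1)))
        (BAnd (Less (cell 20) (Arr 12 (cell 13)))
        (BAnd (orb (eqb (cell 14) (cell 13))
           (BAnd (Less (Const 0) (Arr 0 (cell 14)))
           (BAnd (same_group 14 13) (eqb (cell 18) (Const 0)))))
         (eqb (cell 19) (Const 0)))))"
  have r3: "r3 a = s a" if "a \<notin> {17, 18, 19, 20}" for a
    using that by (simp add: r1_def r2_def r3_def)
  have c: "r3 18 0 = ?c1" "r3 19 0 = ?c2" "r3 20 0 = ?c3"
    by (simp_all add: r1_def r2_def r3_def)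
  have b: "bval ?b r3 \<longleftrightarrow> P"
    unfolding P using grp[OF u(2) v(2)] by (simp add: r3 c)
  have "den exchange s = (if P then upd (upd (upd r3 0 v (?f u)) 0 u (i + 1)) 21 0 1 else r3)"
    unfolding exchange_def den.simps 1 2 3 b by (simp add: r3)
  then show "den exchange s 0 = (if P then (s 0)(v := s 0 u, u := i + 1) else s 0)"
    and "den exchange s 21 0 = (if P then 1 else s 21 0)"
    by (cases P; auto simp: r3)+
qed

text \<open>As long as the flag is 0, the coloring is unchanged and no pair tried so far was
  insertable. Since an insertable pair exists, the exhaustive search cannot end in this way.\<close>

lemma den_insertion:
  assumes s: "prepared s" and v: "s 13 0 = v" "v < n" and k: "k < n"
    and ex: "\<exists>i u. insertable (s 0) v i u"
  shows "\<exists>i u. insertable (s 0) v i u \<and> den insertion s 0 = (s 0)(v := s 0 u, u := i)"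
proof -
  define f where "f = s 0"
  let ?found = "\<lambda>r. r 21 0 = 1 \<and> (\<exists>i u. insertable f v i u \<and> r 0 = f(v := f u, u := i))"
  let ?I = "\<lambda>i r. prepared r \<and> r 13 0 = v \<and>
     (r 21 0 = 0 \<and> r 0 = f \<and> (\<forall>j<i. \<forall>u<n. \<not> insertable f v (j + 1) u) \<or> ?found r)"
  let ?J = "\<lambda>i m r. prepared r \<and> r 13 0 = v \<and> r 15 0 = i \<and>
     (r 21 0 = 0 \<and> r 0 = f \<and> (\<forall>j<i. \<forall>u<n. \<not> insertable f v (j + 1) u) \<and>
       (\<forall>u<m. \<not> insertable f v (i + 1) u) \<or> ?found r)"
  have wf: "well_formed (For 14 exchange)" "well_formed (For 15 (For 14 exchange))"
    by (simp_all add: well_formed_exchange writes_exchange)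
  have inner: "?J i n (den (For 14 exchange) r)" if r: "?I i r" "r 15 0 = i" for i r
  proof -
    have "?J i (r 1 0) (den (For 14 exchange) r)"
    proof (rule den_For_invariant[OF wf(1), where I = "?J i"])
      fix j
      have "prepared (upd r 14 0 j)"
        by (rule prepared_cong[OF conjunct1[OF r(1)]]) (auto simp: upd_other)
      then show "?J i 0 (upd r 14 0 j)" using r by (auto simp: upd_other)
    next
      fix u t j assume u: "u < r 1 0" and t: "?J i u t" "t 14 0 = u"
      have un: "u < n" using u r by (simp add: prepared_def)
      let ?e = "den exchange t"
      have "prepared (upd ?e 14 0 j)"
        by (rule prepared_cong[OF conjunct1[OF t(1)]]) (auto simp: upd_other den_frame writes_exchange)
      moreover have "upd ?e 14 0 j 13 0 = v" "upd ?e 14 0 j 15 0 = i"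
        using t by (auto simp: upd_other den_frame writes_exchange)
      moreover have
        "?e 21 0 = 0 \<and> ?e 0 = f \<and> (\<forall>j<i. \<forall>u<n. \<not> insertable f v (j + 1) u) \<and>
          (\<forall>x<Suc u. \<not> insertable f v (i + 1) x) \<or> ?found ?e"
      proof -
        have e: "?e 0 = (if t 21 0 = 0 \<and> insertable (t 0) v (i + 1) u
            then (t 0)(v := t 0 u, u := i + 1) else t 0)"
          "?e 21 0 = (if t 21 0 = 0 \<and> insertable (t 0) v (i + 1) u then 1 else t 21 0)"
          using den_exchange[of t v u i] t un v(2) by blast+
        from t(1) consider "t 21 0 = 0" "t 0 = f" "\<forall>j<i. \<forall>u<n. \<not> insertable f v (j + 1) u"
            "\<forall>x<u. \<not> insertable f v (i + 1) x" | "?found t"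
          by fast
        then show ?thesis
        proof cases
          case 1
          show ?thesis
          proof (cases "insertable f v (i + 1) u")
            case True
            then have "?found ?e" using 1 e by auto
            then show ?thesis ..
          next
            case False
            then show ?thesis using 1 e by (auto simp: less_Suc_eq)
          qed
        next
          case 2
          then have "?e 0 = t 0" "?e 21 0 = t 21 0" using e by auto
          then show ?thesis using 2 by auto
        qed
      qed
      ultimately show "?J i (Suc u) (upd ?e 14 0 j)" by (simp add: upd_other)
    qed
    then show ?thesis using r by (simp add: prepared_def)
  qed
  let ?s = "upd s 21 0 0"
  have "?I (?s 1 0) (den (For 15 (For 14 exchange)) ?s)"
  proof (rule den_For_invariant[OF wf(2), where I = ?I])
    fix j
    have "prepared (upd ?s 15 0 j)"
      by (rule prepared_cong[OF s]) (auto simp: upd_other)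
    then show "?I 0 (upd ?s 15 0 j)" using v by (auto simp: upd_other upd_same f_def)
  next
    fix i r j assume r: "?I i r" "r 15 0 = i"
    note J = inner[OF r]
    have "prepared (upd (den (For 14 exchange) r) 15 0 j)"
      by (rule prepared_cong[OF conjunct1[OF J]]) (auto simp: upd_other)
    then show "?I (Suc i) (upd (den (For 14 exchange) r) 15 0 j)"
      using J by (auto simp: upd_other less_Suc_eq simp del: den.simps)
  qed
  moreover have "den insertion s = den (For 15 (For 14 exchange)) ?s"
    by (simp add: insertion_def)
  moreover have "?s 1 0 = n" using s by (simp add: prepared_def upd_other)
  \<comment> \<open>Color \<open>i\<close> corresponds to loop index \<open>i - 1\<close>, which is
    below \<open>n\<close> because \<open>k < n\<close>.\<close>
  moreover have "\<not> (\<forall>j<n. \<forall>u<n. \<not> insertable f v (j + 1) u)"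
  proof -
    obtain i u where "insertable f v i u" using ex f_def by blast
    moreover from this have "i - 1 < n" "i - 1 + 1 = i" "u < n"
      using k by (auto simp: insertable_def)
    ultimately show ?thesis by metis
  qed
  ultimately show ?thesis unfolding f_def by (simp del: den.simps) blast
qed

text \<open>In round \<open>q\<close>, exactly the vertices of capacity at most \<open>q\<close> are
  colored, and those of capacity \<open>q + 1\<close> already passed. This is the premise
  \<open>order\<close> of \<open>insertable_exists\<close> at every insertion.\<close>

lemma den_color_all:
  assumes s: "prepared s" "s 0 = (\<lambda>_. 0)" and k: "k < n"
  defines "f \<equiv> den color_all s 0"
  shows "feasible f \<and> (\<forall>x<n. f x \<noteq> 0)"
proof -
  let ?body = "If (eqb (Arr 12 (cell 13)) (Plus (cell 16) (Const 1))) insertion Nop"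
  have wf: "well_formed (For 13 ?body)" "well_formed (For 16 (For 13 ?body))"
    by (simp_all add: insertion_def well_formed_exchange writes_exchange)
  have writes: "writes ?body = {0, 14, 15, 17, 18, 19, 20, 21}"
    by (simp add: writes_insertion)
  let ?I = "\<lambda>q r. prepared r \<and> feasible (r 0) \<and> (\<forall>x<n. r 0 x \<noteq> 0 \<longleftrightarrow> capacity x \<le> q)"
  let ?J = "\<lambda>q m r. prepared r \<and> r 16 0 = q \<and> feasible (r 0) \<and>
     (\<forall>x<n. r 0 x \<noteq> 0 \<longleftrightarrow> capacity x \<le> q \<or> capacity x = q + 1 \<and> x < m)"
  have inner: "?J q n (den (For 13 ?body) r)" if r: "?I q r" "r 16 0 = q" for q r
  proof -
    have "?J q (r 1 0) (den (For 13 ?body) r)"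
    proof (rule den_For_invariant[OF wf(1), where I = "?J q"])
      fix j
      have "prepared (upd r 13 0 j)"
        by (rule prepared_cong[OF conjunct1[OF r(1)]]) (auto simp: upd_other)
      then show "?J q 0 (upd r 13 0 j)" using r by (auto simp: upd_other)
    next
      fix v t j assume v: "v < r 1 0" and t: "?J q v t" "t 13 0 = v"
      have vn: "v < n" using v r by (simp add: prepared_def)
      let ?e = "den ?body t"
      have "prepared (upd ?e 13 0 j)"
        by (rule prepared_cong[OF conjunct1[OF t(1)]])
          (auto simp: upd_other den_frame writes_insertion simp del: den.simps)
      moreover have "upd ?e 13 0 j 16 0 = q"
        using t(1) den_frame[of 16 ?body t] writes by (simp add: upd_other del: den.simps)
      moreover have "feasible (?e 0) \<and>
        (\<forall>x<n. ?e 0 x \<noteq> 0 \<longleftrightarrow> capacity x \<le> q \<or> capacity x = q + 1 \<and> x < Suc v)"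
      proof (cases "capacity v = q + 1")
        case True
        have e: "?e = den insertion t"
          using t True vn by (simp add: prepared_def holds_capacities_def)
        have tv: "t 0 v = 0" using t(1) vn True by force
        have "\<exists>i u. insertable (t 0) v i u"
          by (rule insertable_exists) (use t(1) vn tv True in auto)
        then obtain i u where ins: "insertable (t 0) v i u"
            "den insertion t 0 = (t 0)(v := t 0 u, u := i)"
          using den_insertion[of t v] t vn k by blast
        have "feasible (t 0)" using t(1) by blast
        note F = feasible_insert[OF this _ tv ins(1), folded ins(2)]
        have "?e 0 x \<noteq> 0 \<longleftrightarrow> capacity x \<le> q \<or> capacity x = q + 1 \<and> x < Suc v" if "x < n" for x
          using F(2)[of x] t(1) that vn True unfolding e by (auto simp: less_Suc_eq)
        then show ?thesis using F(1) vn unfolding e by simp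
      next
        case False
        have e: "?e = t"
          using t False vn by (simp add: prepared_def holds_capacities_def)
        have "x < Suc v \<longleftrightarrow> x < v" if "capacity x = q + 1" for x
          using that False by (auto simp: less_Suc_eq)
        then show ?thesis using t(1) unfolding e by auto
      qed
      ultimately show "?J q (Suc v) (upd ?e 13 0 j)" by (simp add: upd_other del: den.simps)
    qed
    then show ?thesis using r by (simp add: prepared_def del: den.simps)
  qed
  have "?I (s 1 0) (den (For 16 (For 13 ?body)) s)"
  proof (rule den_For_invariant[OF wf(2), where I = ?I])
    fix j
    have "prepared (upd s 16 0 j)"
      by (rule prepared_cong[OF s(1)]) (auto simp: upd_other)
    moreover have "feasible (\<lambda>_. 0)" by (auto simp: feasible_def)
    moreover have "\<not> capacity x \<le> 0" if "x < n" for x using capacity_pos[OF that] by simp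
    ultimately show "?I 0 (upd s 16 0 j)" using s(2) by (simp add: upd_other)
  next
    fix q r j assume r: "?I q r" "r 16 0 = q"
    note J = inner[OF r]
    have "prepared (upd (den (For 13 ?body) r) 16 0 j)"
      by (rule prepared_cong[OF conjunct1[OF J]]) (auto simp: upd_other)
    then show "?I (Suc q) (upd (den (For 13 ?body) r) 16 0 j)"
      using J by (auto simp: upd_other le_Suc_eq simp del: den.simps)
  qed
  moreover have "s 1 0 = n" using s by (simp add: prepared_def)
  ultimately show ?thesis using capacity_le unfolding f_def color_all_def
    by (simp del: den.simps)
qed

lemma den_color_prog:
  assumes s: "holds_input s"
  defines "f \<equiv> den color_prog s 0"
  shows "is_coloring {..<n} E k (color_classes n f) \<and> EQ1 w k (color_classes n f)"
proof (cases "k < n")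
  case True
  let ?r = "den compute_capacities (den compute_groups s)"
  have r: "holds_input ?r \<and> holds_groups ?r n \<and> holds_capacities ?r n"
    using den_compute_capacities den_compute_groups[OF s] by blast
  then have "prepared ?r" "?r 0 = (\<lambda>_. 0)" by (auto simp: prepared_def holds_input_def)
  then have "feasible (den color_all ?r 0) \<and> (\<forall>x<n. den color_all ?r 0 x \<noteq> 0)"
    using den_color_all True by blast
  moreover have "f = den color_all ?r 0"
    using s True by (simp add: f_def color_prog_def holds_input_def)
  ultimately show ?thesis using is_coloring_color_classes EQ1_color_classes by simp
next
  case False
  let ?p = "Do 0 (cell 13) (Plus (cell 13) (Const 1))"
  have "\<forall>x<s 1 0. den (For 13 ?p) s 0 x = x + 1"
    by (rule den_For_invariant[where I = "\<lambda>i r. \<forall>x<i. r 0 x = x + 1"])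
      (auto simp: upd_other upd_same less_Suc_eq)
  moreover have "f = den (For 13 ?p) s 0"
    using s False by (simp add: f_def color_prog_def holds_input_def del: den.simps(5))
  moreover have "s 1 0 = n" using s by (simp add: holds_input_def)
  ultimately have f: "f x = x + 1" if "x < n" for x using that by simp
  \<comment> \<open>No class has more than one vertex, so the removal leaves weight 0.\<close>
  have classes: "color_classes n f i = {v. v < n \<and> i = v + 1}" for i
    using f by (auto simp: color_classes_def)
  have "is_coloring {..<n} E k (color_classes n f)"
    using False no_loop unfolding is_coloring_def classes
    by (auto simp: disjoint_family_on_def independent_set_def)
  moreover have "EQ1 w k (color_classes n f)"
    unfolding EQ1_def
  proof (intro ballI impI)
    fix i j assume "color_classes n f i \<noteq> {}"
    then obtain v where v: "v \<in> color_classes n f i" by blast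
    then have "color_classes n f i - {v} = {}" by (auto simp: classes)
    then have "sum w (color_classes n f i - {v}) = 0" by (simp only: sum.empty)
    also have "0 \<le> sum w (color_classes n f j)"
      using nonneg by (intro sum_nonneg) (auto simp: classes)
    finally show "\<exists>v\<in>color_classes n f i. sum w (color_classes n f i - {v}) \<le> sum w (color_classes n f j)"
      using v by blast
  qed
  ultimately show ?thesis ..
qed

end

section \<open>Encoded instances\<close>

text \<open>Cross multiplication with positive denominators; nonnegative numerators are not
  truncated by \<open>nat\<close>.\<close>

lemma quotient_of_less_iff:
  assumes "0 \<le> a" "0 \<le> b"
  shows "nat (fst (quotient_of a)) * nat (snd (quotient_of b)) <
      nat (fst (quotient_of b)) * nat (snd (quotient_of a)) \<longleftrightarrow> a < b"
proof -
  have num: "0 \<le> fst (quotient_of c)" if "0 \<le> c" for c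
  proof -
    have "c = of_int (fst (quotient_of c)) / of_int (snd (quotient_of c))"
      by (simp add: quotient_of_div)
    then show ?thesis
      using that quotient_of_denom_pos'[of c] by (metis divide_neg_pos linorder_not_le of_int_0_less_iff of_int_less_0_iff)
  qed
  have pos: "0 < snd (quotient_of c)" for c by (rule quotient_of_denom_pos')
  have "a < b \<longleftrightarrow> fst (quotient_of a) * snd (quotient_of b) < snd (quotient_of a) * fst (quotient_of b)"
    by (simp add: rat_less_code Let_def case_prod_beta)
  also have "\<dots> \<longleftrightarrow> nat (fst (quotient_of a) * snd (quotient_of b)) <
      nat (fst (quotient_of b) * snd (quotient_of a))"
    using num[OF assms(1)] pos[of b] by (subst nat_less_eq_zless) (auto simp: mult.commute)
  also have "\<dots> \<longleftrightarrow> nat (fst (quotient_of a)) * nat (snd (quotient_of b)) <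
      nat (fst (quotient_of b)) * nat (snd (quotient_of a))"
    using num assms by (simp add: nat_mult_distrib)
  finally show ?thesis by simp
qed

lemma load_encode:
  defines "s \<equiv> \<lambda>n E w k. load (encode (n, E, w, k))"
  shows "s n E w k 0 = (\<lambda>_. 0)" "s n E w k 1 0 = n" "s n E w k 1 1 = k"
    and "u < n \<Longrightarrow> v < n \<Longrightarrow> s n E w k 2 (u * n + v) = of_bool ({u, v} \<in> E)"
    and "v < n \<Longrightarrow> s n E w k 3 v = nat (fst (quotient_of (w v)))"
    and "v < n \<Longrightarrow> s n E w k 4 v = nat (snd (quotient_of (w v)))"
proof -
  show "s n E w k 0 = (\<lambda>_. 0)" by (simp add: s_def load_def fun_eq_iff)
  show "s n E w k 1 0 = n" "s n E w k 1 1 = k" by (simp_all add: s_def load_def encode_def)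
  show "s n E w k 2 (u * n + v) = of_bool ({u, v} \<in> E)" if "u < n" "v < n"
  proof -
    have "u * n + v < Suc u * n" using that by simp
    also have "\<dots> \<le> n * n" using that by (intro mult_right_mono) auto
    finally show ?thesis using that by (simp add: s_def load_def encode_def numeral_2_eq_2)
  qed
  show "s n E w k 3 v = nat (fst (quotient_of (w v)))" if "v < n"
    using that by (simp add: s_def load_def encode_def numeral_3_eq_3)
  have "4 = Suc (Suc (Suc (Suc 0)))" by simp
  then show "s n E w k 4 v = nat (snd (quotient_of (w v)))" if "v < n"
    using that by (simp add: s_def load_def encode_def)
qed

lemma (in coloring_instance) holds_input_load: "holds_input (load (encode (n, E, w, k)))"
  using nonneg by (simp add: holds_input_def load_encode[simplified] quotient_of_less_iff)

lemma length_le_input_size: "length (concat xss) \<le> input_size xss"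
proof -
  have "length ys \<le> sum_list (map bits ys)" for ys
  proof (induction ys)
    case (Cons y ys)
    then show ?case using bits_pos[of y] by simp
  qed simp
  then show ?thesis by (simp only: input_size_def)
qed

text \<open>Although \<open>n\<close> itself is stored in binary, the weights take
  \<open>2 * n\<close> words of at least one bit each, so a polynomial in \<open>n\<close> is
  bounded in terms of the input size.\<close>

lemma vertices_le_input_size: "n + 1 \<le> input_size (encode (n, E, w, k))"
  using length_le_input_size[of "encode (n, E, w, k)"] by (simp add: encode_def)

section \<open>Arbitrary vertex types\<close>

text \<open>The graph is pulled back along a numbering of its vertices and the coloring is pushed
  forward. For the degree an inequality suffices, as the condition on \<open>k\<close> is a lower
  bound.\<close>

lemma EQ1_coloring_transfer:
  fixes V :: "'a set" and n :: nat
  assumes graph: "simple_graph V E" and h: "bij_betw h {..<n} V"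
  defines "F \<equiv> {e. e \<subseteq> {..<n} \<and> h ` e \<in> E}"
  shows "simple_graph {..<n} F" and "max_degree {..<n} F \<le> max_degree V E"
    and "is_coloring {..<n} F k C \<Longrightarrow> is_coloring V E k (\<lambda>i. h ` C i)"
    and "is_coloring {..<n} F k C \<Longrightarrow> EQ1 (w \<circ> h) k C \<Longrightarrow> EQ1 w k (\<lambda>i. h ` C i)"
proof -
  have inj: "inj_on h {..<n}" and im: "h ` {..<n} = V" using h by (auto simp: bij_betw_def)
  note inj' = inj_on_subset[OF inj]
  show "simple_graph {..<n} F"
    using graph card_image[OF inj'] by (auto simp: simple_graph_def F_def)
  have deg: "vertex_degree F v \<le> vertex_degree E (h v)" for v
    unfolding vertex_degree_def
  proof (rule card_inj_on_le[where f = "image h"])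
    show "inj_on (image h) {e \<in> F. v \<in> e}"
      using inj_on_image_Pow[OF inj] by (rule inj_on_subset) (auto simp: F_def)
  qed (use finite_edges[OF graph] in \<open>auto simp: F_def\<close>)
  have "finite V" using graph by (simp add: simple_graph_def)
  then have "vertex_degree F v \<le> Max (vertex_degree E ` V)" if "v < n" for v
    using that im by (intro order.trans[OF deg Max_ge]) auto
  then show "max_degree {..<n} F \<le> max_degree V E"
    using im by (auto simp: max_degree_def)
  {
    assume C: "is_coloring {..<n} F k C"
    have sub: "C i \<subseteq> {..<n}" if "i \<in> {1..k}" for i
      using C that by (auto simp: is_coloring_def)
    have "(\<Union>i\<in>{1..k}. h ` C i) = V"
      using C im by (auto simp: is_coloring_def simp flip: image_UN)
    moreover have "h ` C i \<inter> h ` C j = {}" if "i \<in> {1..k}" "j \<in> {1..k}" "i \<noteq> j" for i j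
      using C that inj_on_image_Int[OF inj sub[OF that(1)] sub[OF that(2)]]
      unfolding is_coloring_def disjoint_family_on_def by (metis image_empty)
    moreover have "independent_set V E (h ` C i)" if i: "i \<in> {1..k}" for i
    proof -
      have "{h a, h b} \<notin> E" if "a \<in> C i" "b \<in> C i" for a b
      proof -
        have "{a, b} \<notin> F" using C i that by (auto simp: is_coloring_def independent_set_def)
        then show ?thesis using sub[OF i] that by (auto simp: F_def)
      qed
      moreover have "h ` C i \<subseteq> V" using sub[OF i] im by blast
      ultimately show ?thesis by (auto simp: independent_set_def)
    qed
    ultimately show "is_coloring V E k (\<lambda>i. h ` C i)"
      by (simp add: is_coloring_def disjoint_family_on_def)
    assume eq: "EQ1 (w \<circ> h) k C"
    show "EQ1 w k (\<lambda>i. h ` C i)"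
      unfolding EQ1_def
    proof (intro ballI impI)
      fix i j assume i: "i \<in> {1..k}" and j: "j \<in> {1..k}" and ne: "h ` C i \<noteq> {}"
      then obtain a where a: "a \<in> C i" "sum (w \<circ> h) (C i - {a}) \<le> sum (w \<circ> h) (C j)"
        using eq unfolding EQ1_def by (metis image_empty)
      have "h ` C i - {h a} = h ` (C i - {a})"
        using inj_on_image_set_diff[OF inj, of "C i" "{a}"] sub[OF i] a(1) by auto
      then have "sum w (h ` C i - {h a}) = sum (w \<circ> h) (C i - {a})"
        using sub[OF i] by (simp only: sum.reindex[OF inj', of "C i - {a}"] Diff_subset[THEN order.trans])
      also note a(2)
      also have "sum (w \<circ> h) (C j) = sum w (h ` C j)"
        using sub[OF j] by (simp only: sum.reindex[OF inj'])
      finally show "\<exists>v\<in>h ` C i. sum w (h ` C i - {v}) \<le> sum w (h ` C j)" using a(1) by blast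
    qed
  }
qed

section \<open>Existence and polynomial-time computation\<close>

theorem theorem3:
  shows
    "(\<forall>(V :: 'a set) (E :: 'a set set) (w :: 'a \<Rightarrow> rat) (k :: nat).
        simple_graph V E \<and> (\<forall>v\<in>V. 0 \<le> w v) \<and>
        1 \<le> k \<and> (8 * card (w ` V) + 10) * max_degree V E \<le> k \<longrightarrow>
        (\<exists>C. is_coloring V E k C \<and> EQ1 w k C)) \<and>
     polytime_solvable
       {(n, E, w, k). simple_graph {..<n} E \<and> (\<forall>v\<in>{..<n}. 0 \<le> w v) \<and>
          1 \<le> k \<and> (8 * card (w ` {..<n}) + 10) * max_degree {..<n} E \<le> k}
       encode
       (\<lambda>(n, E, w, k) out.
          is_coloring {..<n} E k (color_classes n out) \<and> EQ1 w k (color_classes n out))"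
proof (intro conjI allI impI)
  \<comment> \<open>The output of the program serves both claims: existence for arbitrary vertex
    types follows from it after numbering the vertices.\<close>
  have solve: "is_coloring {..<n} E k (color_classes n out) \<and> EQ1 w k (color_classes n out)"
    if "simple_graph {..<n} E" "\<forall>v\<in>{..<n}. 0 \<le> w v" "1 \<le> k"
      "(8 * card (w ` {..<n}) + 10) * max_degree {..<n} E \<le> k"
      "out = den color_prog (load (encode (n, E, w, k))) 0" for n E w k out
  proof -
    interpret coloring_instance n w k E by standard (use that in auto)
    show ?thesis using den_color_prog[OF holds_input_load] that(5) by simp
  qed
  show "polytime_solvable
       {(n, E, w, k). simple_graph {..<n} E \<and> (\<forall>v\<in>{..<n}. 0 \<le> w v) \<and>
          1 \<le> k \<and> (8 * card (w ` {..<n}) + 10) * max_degree {..<n} E \<le> k}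
       encode
       (\<lambda>(n, E, w, k) out.
          is_coloring {..<n} E k (color_classes n out) \<and> EQ1 w k (color_classes n out))"
  proof (rule polytime_solvable_compile[OF well_formed_color_prog])
    fix x :: "nat \<times> nat set set \<times> (nat \<Rightarrow> rat) \<times> nat"
    obtain n E w k where x: "x = (n, E, w, k)" by (cases x)
    show "load (encode x) 1 0 \<le> input_size (encode x)" "0 < input_size (encode x)"
      using vertices_le_input_size[of n E w k] load_encode(2)[of n E w k] unfolding x by linarith+
  qed (use solve in auto)
  fix V :: "'a set" and E and w :: "'a \<Rightarrow> rat" and k :: nat
  assume A: "simple_graph V E \<and> (\<forall>v\<in>V. 0 \<le> w v) \<and>
        1 \<le> k \<and> (8 * card (w ` V) + 10) * max_degree V E \<le> k"
  then have "finite V" by (simp add: simple_graph_def)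
  then obtain h where "bij_betw h {0..<card V} V" using ex_bij_betw_nat_finite by blast
  then have h: "bij_betw h {..<card V} V" by (simp add: atLeast0LessThan)
  then have im: "h ` {..<card V} = V" by (simp add: bij_betw_def)
  let ?F = "{e. e \<subseteq> {..<card V} \<and> h ` e \<in> E}"
  note T = EQ1_coloring_transfer[OF conjunct1[OF A] h]
  have "(8 * card ((w \<circ> h) ` {..<card V}) + 10) * max_degree {..<card V} ?F \<le>
      (8 * card (w ` V) + 10) * max_degree V E"
    unfolding image_comp[symmetric] im using T(2) by (intro mult_left_mono) auto
  also have "\<dots> \<le> k" using A by blast
  finally have "(8 * card ((w \<circ> h) ` {..<card V}) + 10) * max_degree {..<card V} ?F \<le> k" .
  moreover have "\<forall>v\<in>{..<card V}. 0 \<le> (w \<circ> h) v" using A im by auto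
  ultimately obtain C where "is_coloring {..<card V} ?F k C" "EQ1 (w \<circ> h) k C"
    using solve[OF T(1), of "w \<circ> h" k] A by blast
  then show "\<exists>C. is_coloring V E k C \<and> EQ1 w k C" using T(3,4) by blast
qed

end
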